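(* Let $p$ and $q$ be positive integers with $p<q$. For every real $\varepsilon>0$ there is $n_0$ such that for every integer $n\ge n_0$ there exists a graph $G$ on $n$ vertices whose edge density $e(G)/\binom{n}{2}$ lies in $[p/q-\varepsilon,\,p/q+\varepsilon]$ and such that every vertex subset $U\subseteq V(G)$ with $|U|\ge \varepsilon n$ contains $q$ distinct vertices, any $p+1$ of which have fewer than $\varepsilon n$ common neighbors in $G$.
   Context: The paper phrases this asymptotically: "for sufficiently large $n$ there is an $n$-vertex graph with edge density $p/q+o(1)$ such that any subset $U$ of size $\Omega(n)$ contains $q$ vertices, any $p+1$ of which have at most $o(n)$ common neighbors"; the claim above is the quantified form of this asymptotic statement. *)

theory Defs
  imports Complex_Main
begin

definition simple_graph :: "'a set \<Rightarrow> 'a set set \<Rightarrow> bool" where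
  "simple_graph V E \<longleftrightarrow> finite V \<and> (\<forall>e\<in>E. e \<subseteq> V \<and> card e = 2)"

definition edge_density :: "'a set \<Rightarrow> 'a set set \<Rightarrow> real" where
  "edge_density V E = real (card E) / real (card V choose 2)"

text \<open>Members of \<open>S\<close> need no explicit exclusion: for \<open>v = w\<close> the set \<open>{v, w}\<close> is a singleton,
  hence not an edge of a simple graph.\<close>

definition common_neighbors :: "'a set \<Rightarrow> 'a set set \<Rightarrow> 'a set \<Rightarrow> 'a set" where
  "common_neighbors V E S = {w \<in> V. \<forall>v\<in>S. {v, w} \<in> E}"

end

theory Submission
  imports Defs "HOL-Library.FuncSet" "HOL-Number_Theory.Cong"
begin

text \<open>Take words of length \<open>d\<close> over the cyclic alphabet \<open>\<int>/q\<close>, and join \<open>x\<close> to \<open>y\<close> when \<open>x\<close> is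
  among the \<open>p\<close> of its \<open>q\<close> cyclic shifts \<open>x + k\<close> that agree with \<open>y\<close> in the most coordinates. Unless
  there are ties, \<open>y\<close> is adjacent to exactly \<open>p\<close> of the shifts of \<open>x\<close>; hence the density is near \<open>p/q\<close>,
  and no \<open>p + 1\<close> shifts have \<open>y\<close> as a common neighbour. By concentration of the Hamming distance to a
  set, every dense set \<open>U\<close> comes within distance \<open>O(d\<^sup>1\<^sup>/\<^sup>2)\<close> of all shifts of some word \<open>x\<close>. Replacing
  the shifts by nearby elements of \<open>U\<close> perturbs the agreements with a typical \<open>y\<close> only by
  \<open>O(d\<^sup>1\<^sup>/\<^sup>4)\<close>, whereas by anticoncentration their gaps are typically of order \<open>d\<^sup>1\<^sup>/\<^sup>2\<close>. So the adjacencies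
  survive for most \<open>y\<close>. A blow-up of this graph gives all large \<open>n\<close>.\<close>

section \<open>Bounded differences\<close>

definition mean :: "'a set \<Rightarrow> ('a \<Rightarrow> real) \<Rightarrow> real" where
  "mean S f = (\<Sum>x\<in>S. f x) / real (card S)"

lemma sum_eq_card_mean:
  assumes "finite S"
  shows "(\<Sum>x\<in>S. f x) = real (card S) * mean S f"
  using assms by (cases "S = {}") (simp_all add: mean_def)

text \<open>The cross term vanishes because deviations from the mean sum to zero. This is the
  identity that splits a variance into a conditional part and a part coming from the conditional
  means.\<close>

lemma sum_sq_dev_shift:
  assumes "finite S"
  shows "(\<Sum>x\<in>S. (f x - c)\<^sup>2) = (\<Sum>x\<in>S. (f x - mean S f)\<^sup>2) + real (card S) * (mean S f - c)\<^sup>2"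
proof -
  let ?m = "mean S f"
  have "(\<Sum>x\<in>S. (f x - c)\<^sup>2) = (\<Sum>x\<in>S. (f x - ?m)\<^sup>2 + 2 * (?m - c) * (f x - ?m) + (?m - c)\<^sup>2)"
    by (intro sum.cong) (auto simp: power2_eq_square algebra_simps)
  also have "\<dots> = (\<Sum>x\<in>S. (f x - ?m)\<^sup>2) + 2 * (?m - c) * (\<Sum>x\<in>S. f x - ?m) + real (card S) * (?m - c)\<^sup>2"
    by (simp add: sum.distrib sum_distrib_left)
  also have "(\<Sum>x\<in>S. f x - ?m) = 0"
    using sum_eq_card_mean[OF assms, of f] by (simp add: sum_subtractf)
  finally show ?thesis by simp
qed

lemma card_filter_eq_sum:
  assumes "finite A"
  shows "real (card {x\<in>A. P x}) = (\<Sum>x\<in>A. of_bool (P x))"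
proof -
  have "A \<inter> {x. P x} = {x\<in>A. P x}" by blast
  then show ?thesis using assms by (simp only: sum_of_bool_eq)
qed

lemma sum_PiE_insert:
  assumes "i \<notin> I"
  shows "(\<Sum>x\<in>insert i I \<rightarrow>\<^sub>E A. f x) = (\<Sum>x\<in>I \<rightarrow>\<^sub>E A. \<Sum>a\<in>A. f (x(i := a)))"
proof -
  have "(\<Sum>x\<in>insert i I \<rightarrow>\<^sub>E A. f x) = (\<Sum>(a, x)\<in>A \<times> (I \<rightarrow>\<^sub>E A). f (x(i := a)))"
    unfolding PiE_insert_eq
    by (subst sum.reindex[OF inj_combinator[OF assms]])
      (simp add: case_prod_unfold)
  also have "\<dots> = (\<Sum>a\<in>A. \<Sum>x\<in>I \<rightarrow>\<^sub>E A. f (x(i := a)))"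
    by (simp add: sum.cartesian_product)
  finally show ?thesis by (simp add: sum.swap[of _ A])
qed

text \<open>An Efron-Stein type bound, proved one coordinate at a time: averaging \<open>f\<close>
  over the new coordinate gives a function \<open>g\<close> with the same difference bounds in the
  old coordinates. The variance of \<open>f\<close> is the average of the conditional variances,
  each at most the square of \<open>c i\<close>, plus the variance of \<open>g\<close>.\<close>

theorem bounded_differences_variance:
  fixes f :: "('i \<Rightarrow> 'a) \<Rightarrow> real"
  assumes "finite I" and "finite A" "A \<noteq> {}"
    and "\<And>x i a. x \<in> I \<rightarrow>\<^sub>E A \<Longrightarrow> i \<in> I \<Longrightarrow> a \<in> A \<Longrightarrow> \<bar>f (x(i := a)) - f x\<bar> \<le> c i"
  shows "(\<Sum>x\<in>I \<rightarrow>\<^sub>E A. (f x - mean (I \<rightarrow>\<^sub>E A) f)\<^sup>2) \<le> real (card (I \<rightarrow>\<^sub>E A)) * (\<Sum>i\<in>I. (c i)\<^sup>2)"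
  using assms(1,4)
proof (induction I arbitrary: f rule: finite_induct)
  case empty
  then show ?case by (simp add: mean_def)
next
  case (insert i I)
  let ?P = "I \<rightarrow>\<^sub>E A" and ?P' = "insert i I \<rightarrow>\<^sub>E A"
  define g where "g x = mean A (\<lambda>a. f (x(i := a)))" for x
  have A0: "real (card A) > 0" using assms(2,3) by (simp add: card_gt_0_iff)
  have cardP: "real (card ?P') = real (card A) * real (card ?P)"
    using insert.hyps by (simp add: card_PiE)
  have upd: "x(i := a) \<in> ?P'" if "x \<in> ?P" "a \<in> A" for x a
    using that by (auto simp: PiE_def extensional_def Pi_def)
  have fin: "finite ?P" using insert.hyps assms(2) by (simp add: finite_PiE)
  have mg: "mean ?P g = mean ?P' f"
  proof -
    have "(\<Sum>x\<in>?P'. f x) = (\<Sum>x\<in>?P. real (card A) * g x)"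
      unfolding sum_PiE_insert[OF insert.hyps(2)] g_def
      by (intro sum.cong) (simp_all add: sum_eq_card_mean[OF assms(2)])
    then show ?thesis
      unfolding mean_def cardP using A0 by (simp add: sum_distrib_left[symmetric])
  qed
  have gd: "\<bar>g (x(j := a)) - g x\<bar> \<le> c j" if "x \<in> ?P" "j \<in> I" "a \<in> A" for x j a
  proof -
    have "j \<noteq> i" using that insert.hyps by auto
    have "\<bar>\<Sum>b\<in>A. f ((x(j := a))(i := b)) - f (x(i := b))\<bar> \<le> (\<Sum>b\<in>A. c j)"
    proof (rule order_trans[OF sum_abs sum_mono])
      fix b assume "b \<in> A"
      have "\<bar>f ((x(i := b))(j := a)) - f (x(i := b))\<bar> \<le> c j"
        using that \<open>b \<in> A\<close> by (intro insert.prems upd) auto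
      then show "\<bar>f ((x(j := a))(i := b)) - f (x(i := b))\<bar> \<le> c j"
        using \<open>j \<noteq> i\<close> by (simp add: fun_upd_twist)
    qed
    then have "\<bar>g (x(j := a)) - g x\<bar> * card A \<le> c j * card A"
      using A0 unfolding g_def mean_def sum_subtractf diff_divide_distrib[symmetric]
      by (simp add: abs_divide mult.commute)
    then show ?thesis using A0 by simp
  qed
  \<comment> \<open>The deviation from \<open>g x\<close> is an average, over \<open>b\<close>, of
    changes at the single coordinate \<open>i\<close>, so it inherits the bound
    \<open>c i\<close>.\<close>
  have inner: "(\<Sum>a\<in>A. (f (x(i := a)) - g x)\<^sup>2) \<le> real (card A) * (c i)\<^sup>2" if x: "x \<in> ?P" for x
  proof -
    have "(f (x(i := a)) - g x)\<^sup>2 \<le> (c i)\<^sup>2" if a: "a \<in> A" for a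
    proof -
      have "\<bar>\<Sum>b\<in>A. f (x(i := a)) - f (x(i := b))\<bar> \<le> (\<Sum>b\<in>A. c i)"
      proof (rule order_trans[OF sum_abs sum_mono])
        fix b assume "b \<in> A"
        then have "\<bar>f ((x(i := b))(i := a)) - f (x(i := b))\<bar> \<le> c i"
          using x a by (intro insert.prems upd) auto
        then show "\<bar>f (x(i := a)) - f (x(i := b))\<bar> \<le> c i" by simp
      qed
      also have "(\<Sum>b\<in>A. f (x(i := a)) - f (x(i := b))) = real (card A) * (f (x(i := a)) - g x)"
        by (simp add: sum_subtractf g_def sum_eq_card_mean[OF assms(2)] algebra_simps)
      finally have "\<bar>f (x(i := a)) - g x\<bar> \<le> c i"
        using A0 by (simp add: abs_mult)
      then show ?thesis by (metis abs_ge_zero power2_abs power_mono)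
    qed
    then show ?thesis by (intro sum_bounded_above)
  qed
  have "(\<Sum>x\<in>?P'. (f x - mean ?P' f)\<^sup>2)
      = (\<Sum>x\<in>?P. (\<Sum>a\<in>A. (f (x(i := a)) - g x)\<^sup>2) + real (card A) * (g x - mean ?P g)\<^sup>2)"
    unfolding sum_PiE_insert[OF insert.hyps(2)] mg
    by (intro sum.cong refl) (simp add: sum_sq_dev_shift[OF assms(2), where c = "mean ?P' f"] g_def)
  also have "\<dots> \<le> (\<Sum>x\<in>?P. real (card A) * (c i)\<^sup>2 + real (card A) * (g x - mean ?P g)\<^sup>2)"
    by (intro sum_mono add_right_mono inner)
  also have "\<dots> = real (card A) * (real (card ?P) * (c i)\<^sup>2 + (\<Sum>x\<in>?P. (g x - mean ?P g)\<^sup>2))"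
    by (simp add: sum.distrib sum_distrib_left algebra_simps)
  also have "\<dots> \<le> real (card A) * (real (card ?P) * (c i)\<^sup>2 + real (card ?P) * (\<Sum>j\<in>I. (c j)\<^sup>2))"
    by (intro mult_left_mono add_left_mono insert.IH gd) auto
  also have "\<dots> = real (card ?P') * (\<Sum>j\<in>insert i I. (c j)\<^sup>2)"
    using insert.hyps by (simp add: cardP algebra_simps)
  finally show ?case .
qed

section \<open>Counting tools: Chebyshev's inequality, ranks, a union bound over pairs\<close>

lemma chebyshev_card:
  assumes "finite S" "0 < g" "(\<Sum>x\<in>S. (f x - c)\<^sup>2) \<le> v"
  shows "real (card {x\<in>S. g \<le> \<bar>f x - c\<bar>}) \<le> v / g\<^sup>2"
proof -
  let ?B = "{x\<in>S. g \<le> \<bar>f x - c\<bar>}"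
  have "real (card ?B) * g\<^sup>2 = (\<Sum>x\<in>?B. g\<^sup>2)" by simp
  also have "\<dots> \<le> (\<Sum>x\<in>?B. (f x - c)\<^sup>2)"
  proof (rule sum_mono)
    fix x assume "x \<in> ?B"
    then show "g\<^sup>2 \<le> (f x - c)\<^sup>2"
      using assms(2) by (metis (mono_tags, lifting) mem_Collect_eq less_imp_le power2_abs power_mono)
  qed
  also have "\<dots> \<le> (\<Sum>x\<in>S. (f x - c)\<^sup>2)"
    using assms(1) by (intro sum_mono2) auto
  finally show ?thesis using assms(2,3) by (simp add: field_simps)
qed

text \<open>Without ties, the rank map sending \<open>k\<close> to the number of larger values is
  injective, hence a bijection onto the numbers below \<open>card T\<close>; exactly
  \<open>p\<close> of these are less than \<open>p\<close>.\<close>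

lemma card_top_ranks:
  fixes a :: "nat \<Rightarrow> real"
  assumes "finite T" "inj_on a T" "p \<le> card T"
  shows "card {k\<in>T. card {l\<in>T. a k < a l} < p} = p"
proof -
  define r where "r k = card {l\<in>T. a k < a l}" for k
  have mono: "r k < r l" if "k \<in> T" "l \<in> T" "a l < a k" for k l
    unfolding r_def by (rule psubset_card_mono) (use that assms(1) in auto)
  have inj: "inj_on r T"
  proof (rule inj_onI)
    fix k l assume "k \<in> T" "l \<in> T" "r k = r l"
    then have "a k = a l" using mono by (metis less_irrefl linorder_neqE_linordered_idom)
    then show "k = l" using assms(2) \<open>k \<in> T\<close> \<open>l \<in> T\<close> by (meson inj_onD)
  qed
  have "r ` T \<subseteq> {..<card T}"
    unfolding r_def using assms(1) by (auto intro!: psubset_card_mono)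
  then have img: "r ` T = {..<card T}"
    by (intro card_subset_eq) (simp_all add: card_image[OF inj])
  have "r ` {k\<in>T. r k < p} = {..<p}"
    using img assms(3) by (auto simp: image_iff set_eq_iff) (metis less_le_trans lessThan_iff)+
  moreover have "inj_on r {k\<in>T. r k < p}" using inj by (rule inj_on_subset) auto
  ultimately show ?thesis unfolding r_def[symmetric] by (metis card_image card_lessThan)
qed

lemma card_square_UN_le:
  fixes b :: real
  assumes "\<And>k l. k < q \<Longrightarrow> l < q \<Longrightarrow> real (card (B k l)) \<le> b"
  shows "real (card (\<Union>k<q. \<Union>l<q. B k l)) \<le> real q ^ 2 * b"
proof -
  have "card (\<Union>k<q. \<Union>l<q. B k l) \<le> (\<Sum>k<q. card (\<Union>l<q. B k l))"
    by (rule card_UN_le) simp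
  also have "\<dots> \<le> (\<Sum>k<q. \<Sum>l<q. card (B k l))"
    by (intro sum_mono card_UN_le) simp
  finally have "real (card (\<Union>k<q. \<Union>l<q. B k l)) \<le> real (\<Sum>k<q. \<Sum>l<q. card (B k l))"
    by (rule of_nat_mono)
  also have "\<dots> = (\<Sum>k<q. \<Sum>l<q. real (card (B k l)))" by (simp only: of_nat_sum)
  also have "\<dots> \<le> (\<Sum>k<q. \<Sum>l<q. b)" by (intro sum_mono assms) auto
  finally show ?thesis by (simp add: power2_eq_square)
qed

section \<open>Words over the cyclic alphabet\<close>

text \<open>This is \<open>d\<close> minus the Hamming distance on the first \<open>d\<close>
  coordinates, taken as a real because its means and variances are needed.\<close>

definition agr :: "nat \<Rightarrow> (nat \<Rightarrow> nat) \<Rightarrow> (nat \<Rightarrow> nat) \<Rightarrow> real" where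
  "agr d x y = (\<Sum>i<d. of_bool (x i = y i))"

lemma agr_commute: "agr d x y = agr d y x"
  unfolding agr_def by (intro sum.cong) (auto simp: eq_commute)

lemma agr_refl [simp]: "agr d x x = real d"
  by (simp add: agr_def)

lemma agr_fun_upd:
  assumes "i < d"
  shows "agr d (x(i := c)) y = agr d x y + of_bool (c = y i) - of_bool (x i = y i)"
proof -
  have "agr d z y = of_bool (z i = y i) + (\<Sum>j\<in>{..<d} - {i}. of_bool (z j = y j))" for z
    unfolding agr_def using assms by (subst sum.remove[of _ i]) auto
  moreover have "(\<Sum>j\<in>{..<d} - {i}. of_bool ((x(i := c)) j = y j) :: real) = (\<Sum>j\<in>{..<d} - {i}. of_bool (x j = y j))"
    by (intro sum.cong) auto
  ultimately show ?thesis by (simp only: fun_upd_same)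
qed

locale words =
  fixes d q :: nat
  assumes q_pos: "0 < q"
begin

definition W :: "(nat \<Rightarrow> nat) set" where
  "W = {..<d} \<rightarrow>\<^sub>E {..<q}"

text \<open>Restricting to \<open>{..<d}\<close> keeps shifts extensional, so that every shift lies
  in \<open>W\<close> and the shifts form a cyclic action on it.\<close>

definition sh :: "nat \<Rightarrow> (nat \<Rightarrow> nat) \<Rightarrow> nat \<Rightarrow> nat" where
  "sh k x = (\<lambda>i\<in>{..<d}. (x i + k) mod q)"

lemma finite_W [simp]: "finite W"
  by (simp add: W_def finite_PiE)

lemma card_W: "card W = q ^ d"
  by (simp add: W_def card_PiE)

lemma card_W_pos: "0 < real (card W)"
  using q_pos by (simp add: card_W)

lemma W_nonempty: "W \<noteq> {}"
  using card_W_pos by (metis card.empty of_nat_0 less_irrefl)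

lemma W_fun_upd: "x \<in> W \<Longrightarrow> i < d \<Longrightarrow> c < q \<Longrightarrow> x(i := c) \<in> W"
  by (auto simp: W_def PiE_def extensional_def Pi_def)

lemma W_eqI: "x \<in> W \<Longrightarrow> y \<in> W \<Longrightarrow> (\<And>i. i < d \<Longrightarrow> x i = y i) \<Longrightarrow> x = y"
  unfolding W_def by (rule PiE_ext) auto

lemma W_lt: "x \<in> W \<Longrightarrow> i < d \<Longrightarrow> x i < q"
  by (auto simp: W_def)

lemma sh_in_W [simp]: "sh k x \<in> W"
  using q_pos by (auto simp: sh_def W_def)

lemma sh_apply: "i < d \<Longrightarrow> sh k x i = (x i + k) mod q"
  by (simp add: sh_def)

lemma sh_sh: "sh j (sh k x) = sh (k + j) x"
  by (auto simp: sh_def fun_eq_iff mod_simps add.assoc)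

lemma sh_mod: "sh (k mod q) x = sh k x"
  by (auto simp: sh_def fun_eq_iff mod_simps)

lemma sh_0: "x \<in> W \<Longrightarrow> sh 0 x = x"
  by (rule W_eqI) (auto simp: sh_apply W_lt)

lemma sh_q: "x \<in> W \<Longrightarrow> sh q x = x"
  using sh_mod[of q x] by (simp add: sh_0)

lemma bij_sh: "bij_betw (sh k) W W"
proof (rule bij_betw_byWitness[where f' = "sh (q - k mod q)"])
  have "(k + (q - k mod q)) mod q = (k mod q + (q - k mod q)) mod q"
    by (rule mod_add_left_eq[symmetric])
  also have "k mod q + (q - k mod q) = q"
    using mod_less_divisor[OF q_pos, of k] by linarith
  finally have *: "(k + (q - k mod q)) mod q = 0" by (simp only: mod_self)
  have inv: "sh (k + (q - k mod q)) x = x" if "x \<in> W" for x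
    by (subst sh_mod[symmetric]) (simp only: * sh_0[OF that])
  show "\<forall>x\<in>W. sh (q - k mod q) (sh k x) = x"
    unfolding sh_sh using inv by blast
  show "\<forall>x\<in>W. sh k (sh (q - k mod q) x) = x"
    using inv by (simp add: sh_sh add.commute)
qed (blast intro: sh_in_W)+

lemma sum_sh: "(\<Sum>x\<in>W. f (sh k x)) = (\<Sum>x\<in>W. f x)"
  by (rule sum.reindex_bij_betw[OF bij_sh])

lemma card_sh: "card {x\<in>W. P (sh k x)} = card {x\<in>W. P x}"
proof (rule bij_betw_same_card)
  have "inj_on (sh k) {x\<in>W. P (sh k x)}"
    using bij_sh[of k] by (auto simp: bij_betw_def intro: inj_on_subset)
  moreover have "sh k ` {x\<in>W. P (sh k x)} = {x\<in>W. P x}"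
  proof (intro equalityI subsetI)
    fix x assume x: "x \<in> {x\<in>W. P x}"
    then obtain z where "z \<in> W" "x = sh k z"
      using bij_betw_imp_surj_on[OF bij_sh[of k]] by (metis (no_types, lifting) imageE mem_Collect_eq)
    then show "x \<in> sh k ` {x\<in>W. P (sh k x)}" using x by blast
  qed auto
  ultimately show "bij_betw (sh k) {x\<in>W. P (sh k x)} {x\<in>W. P x}"
    by (simp add: bij_betw_def)
qed

lemma agr_sh_sh:
  assumes "x \<in> W" "y \<in> W"
  shows "agr d (sh k x) (sh k y) = agr d x y"
  unfolding agr_def
proof (rule sum.cong[OF refl])
  fix i assume "i \<in> {..<d}"
  then have i: "i < d" by simp
  have "(x i + k) mod q = (y i + k) mod q \<longleftrightarrow> x i = y i"
    using W_lt[OF assms(1) i] W_lt[OF assms(2) i]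
    by (metis cong_def cong_add_rcancel_nat mod_less)
  then show "(of_bool (sh k x i = sh k y i) :: real) = of_bool (x i = y i)"
    by (simp add: sh_apply i)
qed

text \<open>In each coordinate exactly one of the \<open>q\<close> shifts of \<open>x\<close>
  carries the letter of \<open>y\<close>.\<close>

lemma sum_agr_sh:
  assumes "y \<in> W"
  shows "(\<Sum>k<q. agr d y (sh k x)) = real d"
proof -
  have one: "(\<Sum>k<q. of_bool (y i = sh k x i) :: real) = 1" if i: "i < d" for i
  proof -
    \<comment> \<open>This is \<open>y i - x i\<close> modulo \<open>q\<close>. The letter
      \<open>x i\<close> is reduced first because \<open>x\<close> is arbitrary and the natural
      subtraction must not truncate.\<close>
    define k0 where "k0 = (y i + (q - x i mod q)) mod q"
    have "y i = (x i + k) mod q \<longleftrightarrow> k = k0" if "k < q" for k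
    proof -
      have 1: "(x i + k0) mod q = y i"
      proof -
        have "(x i + k0) mod q = (x i mod q + (y i + (q - x i mod q))) mod q"
          unfolding k0_def by (simp only: mod_simps)
        also have "x i mod q + (y i + (q - x i mod q)) = y i + q"
          using mod_less_divisor[OF q_pos, of "x i"] by linarith
        also have "(y i + q) mod q = y i mod q" by simp
        finally show ?thesis using W_lt[OF assms i] by simp
      qed
      have "k0 < q" using q_pos by (simp add: k0_def)
      then show ?thesis using 1 that by (metis cong_def cong_add_lcancel_nat mod_less)
    qed
    then have "(\<Sum>k<q. of_bool (y i = sh k x i) :: real) = (\<Sum>k<q. of_bool (k = k0))"
      by (intro sum.cong) (auto simp: sh_apply i)
    also have "\<dots> = 1" using q_pos by (simp add: k0_def of_bool_def)
    finally show ?thesis .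
  qed
  have "(\<Sum>k<q. agr d y (sh k x)) = (\<Sum>i<d. \<Sum>k<q. of_bool (y i = sh k x i))"
    unfolding agr_def by (rule sum.swap)
  also have "\<dots> = (\<Sum>i<d. 1)" by (rule sum.cong[OF refl]) (simp only: one lessThan_iff)
  also have "\<dots> = real d" by simp
  finally show ?thesis .
qed

text \<open>Shifting both words shows that every shift of \<open>x\<close> has the same total
  agreement over \<open>W\<close>; by \<open>sum_agr_sh\<close> the \<open>q\<close> shifts together
  have total \<open>d\<close> for each \<open>y\<close>.\<close>

lemma sum_agr:
  assumes "x \<in> W"
  shows "(\<Sum>y\<in>W. agr d y x) = real (card W) * (real d / real q)"
proof -
  have "(\<Sum>y\<in>W. agr d y (sh k x)) = (\<Sum>y\<in>W. agr d y x)" for k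
  proof -
    have "(\<Sum>y\<in>W. agr d y (sh k x)) = (\<Sum>y\<in>W. agr d (sh k y) (sh k x))"
      by (rule sum_sh[symmetric])
    then show ?thesis using assms by (simp add: agr_sh_sh)
  qed
  then have "real q * (\<Sum>y\<in>W. agr d y x) = (\<Sum>k<q. \<Sum>y\<in>W. agr d y (sh k x))" by simp
  also have "\<dots> = (\<Sum>y\<in>W. \<Sum>k<q. agr d y (sh k x))" by (rule sum.swap)
  also have "\<dots> = real (card W) * real d" by (simp add: sum_agr_sh)
  finally show ?thesis using q_pos by (simp add: field_simps)
qed

lemma variance_W:
  assumes "\<And>x i a. x \<in> W \<Longrightarrow> i < d \<Longrightarrow> a < q \<Longrightarrow> \<bar>f (x(i := a)) - f x\<bar> \<le> c i"
  shows "(\<Sum>x\<in>W. (f x - mean W f)\<^sup>2) \<le> real (card W) * (\<Sum>i<d. (c i)\<^sup>2)"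
  using assms q_pos unfolding W_def by (intro bounded_differences_variance) auto

lemma variance_agr:
  assumes "x \<in> W"
  shows "(\<Sum>y\<in>W. (agr d y x - real d / real q)\<^sup>2) \<le> real (card W) * real d"
proof -
  have "mean W (\<lambda>y. agr d y x) = real d / real q"
    unfolding mean_def sum_agr[OF assms]
    by (rule nonzero_mult_div_cancel_left) (use card_W_pos in linarith)
  moreover have "(\<Sum>y\<in>W. (agr d y x - mean W (\<lambda>y. agr d y x))\<^sup>2) \<le> real (card W) * (\<Sum>i<d. 1\<^sup>2)"
    by (rule variance_W) (simp add: agr_fun_upd)
  ultimately show ?thesis by simp
qed

text \<open>Only coordinates where \<open>u\<close> and \<open>v\<close> differ influence the
  difference, so its variance is governed by the Hamming distance of \<open>u\<close> and
  \<open>v\<close> instead of by \<open>d\<close>. This makes nearby words interchangeable for most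
  \<open>y\<close>.\<close>

lemma variance_agr_diff:
  assumes "u \<in> W" "v \<in> W"
  shows "(\<Sum>y\<in>W. (agr d y u - agr d y v)\<^sup>2) \<le> real (card W) * (4 * (real d - agr d u v))"
proof -
  let ?f = "\<lambda>y. agr d y u - agr d y v"
  have "mean W ?f = 0"
    unfolding mean_def sum_subtractf using assms by (simp add: sum_agr)
  moreover have "(\<Sum>y\<in>W. (?f y - mean W ?f)\<^sup>2) \<le> real (card W) * (\<Sum>i<d. (2 * of_bool (u i \<noteq> v i))\<^sup>2)"
    by (rule variance_W) (auto simp: agr_fun_upd of_bool_def)
  moreover have "(\<Sum>i<d. (2 * of_bool (u i \<noteq> v i) :: real)\<^sup>2) = 4 * (\<Sum>i<d. 1 - of_bool (u i = v i))"
    unfolding sum_distrib_left by (intro sum.cong) auto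
  ultimately show ?thesis by (simp add: sum_subtractf agr_def)
qed

subsection \<open>Anticoncentration\<close>

text \<open>Both sides count pairs of a word and a coordinate: replacing the letter of \<open>b\<close> by the
  letter of \<open>a\<close> at one coordinate raises the difference of the agreements by two.\<close>

lemma exchange:
  assumes a: "a \<in> W" and b: "b \<in> W" and ne: "\<forall>i<d. a i \<noteq> b i"
  shows "(\<Sum>y\<in>{y\<in>W. P (agr d y a - agr d y b)}. agr d y b)
       = (\<Sum>y\<in>{y\<in>W. P (agr d y a - agr d y b - 2)}. agr d y a)"
proof -
  let ?S = "\<lambda>y. agr d y a - agr d y b"
  have expand: "(\<Sum>y\<in>{y\<in>W. R y}. agr d y c) = (\<Sum>i<d. real (card {y\<in>W. R y \<and> y i = c i}))" for R c
  proof -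
    have "(\<Sum>y\<in>{y\<in>W. R y}. agr d y c) = (\<Sum>i<d. \<Sum>y\<in>{y\<in>W. R y}. of_bool (y i = c i))"
      unfolding agr_def by (rule sum.swap)
    moreover have "{y\<in>W. R y} \<inter> {y. y i = c i} = {y\<in>W. R y \<and> y i = c i}" for i
      by blast
    ultimately show ?thesis by (simp only: sum_of_bool_eq finite_Collect_conjI finite_W Collect_mem_eq simp_thms)
  qed
  have "card {y\<in>W. P (?S y) \<and> y i = b i} = card {y\<in>W. P (?S y - 2) \<and> y i = a i}" if i: "i < d" for i
  proof (rule bij_betw_same_card)
    show "bij_betw (\<lambda>y. y(i := a i)) {y\<in>W. P (?S y) \<and> y i = b i} {y\<in>W. P (?S y - 2) \<and> y i = a i}"
    proof (rule bij_betw_byWitness[where f' = "\<lambda>y. y(i := b i)"])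
      show "(\<lambda>y. y(i := a i)) ` {y\<in>W. P (?S y) \<and> y i = b i} \<subseteq> {y\<in>W. P (?S y - 2) \<and> y i = a i}"
      proof (rule image_subsetI)
        fix y assume "y \<in> {y\<in>W. P (?S y) \<and> y i = b i}"
        then have y: "y \<in> W" "P (?S y)" "y i = b i" by auto
        have "?S (y(i := a i)) - 2 = ?S y"
          using i y(3) ne by (force simp: agr_fun_upd)
        then show "y(i := a i) \<in> {y\<in>W. P (?S y - 2) \<and> y i = a i}"
          using y W_fun_upd[OF y(1) i W_lt[OF a i]] by (simp del: fun_upd_apply) simp
      qed
      show "(\<lambda>y. y(i := b i)) ` {y\<in>W. P (?S y - 2) \<and> y i = a i} \<subseteq> {y\<in>W. P (?S y) \<and> y i = b i}"
      proof (rule image_subsetI)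
        fix y assume "y \<in> {y\<in>W. P (?S y - 2) \<and> y i = a i}"
        then have y: "y \<in> W" "P (?S y - 2)" "y i = a i" by auto
        have "?S (y(i := b i)) = ?S y - 2"
          using i y(3) ne by (force simp: agr_fun_upd)
        then show "y(i := b i) \<in> {y\<in>W. P (?S y) \<and> y i = b i}"
          using y W_fun_upd[OF y(1) i W_lt[OF b i]] by (simp del: fun_upd_apply) simp
      qed
    qed (auto simp: fun_upd_idem)
  qed
  then show ?thesis unfolding expand by simp
qed

end

text \<open>With \<open>d = m\<^sup>6\<close> the threshold \<open>m\<^sup>2\<close> lies between the perturbations, of order \<open>d\<^sup>1\<^sup>/\<^sup>4\<close>, and the
  gaps, of order \<open>d\<^sup>1\<^sup>/\<^sup>2\<close>; \<open>K = m\<^sup>1\<^sup>/\<^sup>2\<close> is the number of disjoint windows in the anticoncentration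
  argument.\<close>

locale scaled_words = words d q for d q :: nat +
  fixes m K :: nat
  assumes K_pos: "0 < K" and m_eq: "m = K\<^sup>2" and d_eq: "d = m ^ 6"
begin

lemma m_pos: "0 < m"
  using K_pos by (simp add: m_eq)

lemma d_eq_sq: "real d = real m ^ 3 * real m ^ 3"
  by (simp add: d_eq power_add[symmetric])

text \<open>A first moment bound from the variance: the inequality \<open>am_gm\<close>, taken with
  \<open>c = m ^ 3\<close>, the square root of \<open>d\<close>, does the work of
  Cauchy-Schwarz.\<close>

lemma sum_abs_dev_agr:
  assumes "x \<in> W"
  shows "(\<Sum>y\<in>W. \<bar>agr d y x - real d / real q\<bar>) \<le> real (card W) * real m ^ 3"
proof -
  let ?z = "\<lambda>y. agr d y x - real d / real q"
  have m: "real m ^ 3 > 0" using m_pos by simp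
  have am_gm: "\<bar>z\<bar> \<le> (z\<^sup>2 / c + c) / 2" if "0 < c" for z c :: real
  proof -
    have "0 \<le> (\<bar>z\<bar> - c)\<^sup>2" by simp
    then have "2 * (\<bar>z\<bar> * c) \<le> z\<^sup>2 + c * c" by (simp add: power2_diff power2_eq_square[of c])
    then show ?thesis using that by (simp add: field_simps)
  qed
  have "(\<Sum>y\<in>W. \<bar>?z y\<bar>) \<le> (\<Sum>y\<in>W. ((?z y)\<^sup>2 / real m ^ 3 + real m ^ 3) / 2)"
    by (intro sum_mono am_gm m)
  also have "\<dots> = ((\<Sum>y\<in>W. (?z y)\<^sup>2) / real m ^ 3 + real (card W) * real m ^ 3) / 2"
    by (simp add: sum.distrib sum_divide_distrib[symmetric])
  also have "\<dots> \<le> ((real (card W) * real d) / real m ^ 3 + real (card W) * real m ^ 3) / 2"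
    using variance_agr[OF assms] m by (intro divide_right_mono add_right_mono) auto
  also have "real (card W) * real d / real m ^ 3 = real (card W) * real m ^ 3"
    unfolding d_eq_sq using m by (metis mult.assoc nonzero_mult_div_cancel_right order_less_irrefl)
  finally show ?thesis by (simp add: mult.commute)
qed

text \<open>The weights on both sides of \<open>exchange\<close> equal \<open>d / q\<close> up to a
  total error of \<open>card W * m ^ 3\<close>. Replacing them by \<open>d / q\<close> and dividing
  by it turns the weighted identity into a comparison of cardinalities.\<close>

lemma card_shift_two:
  assumes a: "a \<in> W" and b: "b \<in> W" and ne: "\<forall>i<d. a i \<noteq> b i"
  shows "real (card {y\<in>W. P (agr d y a - agr d y b)})
    \<le> real (card {y\<in>W. P (agr d y a - agr d y b - 2)}) + 2 * real q * real (card W) / real m ^ 3"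
proof -
  let ?A = "{y\<in>W. P (agr d y a - agr d y b)}" and ?B = "{y\<in>W. P (agr d y a - agr d y b - 2)}"
  let ?D = "real d / real q"
  have m: "real m > 0" using m_pos by simp
  have dev: "\<bar>(\<Sum>y\<in>X. agr d y x) - real (card X) * ?D\<bar> \<le> real (card W) * real m ^ 3"
    if "x \<in> W" "X \<subseteq> W" for x X
  proof -
    have "\<bar>(\<Sum>y\<in>X. agr d y x) - real (card X) * ?D\<bar> = \<bar>\<Sum>y\<in>X. agr d y x - ?D\<bar>"
      by (simp add: sum_subtractf)
    also have "\<dots> \<le> (\<Sum>y\<in>X. \<bar>agr d y x - ?D\<bar>)" by (rule sum_abs)
    also have "\<dots> \<le> (\<Sum>y\<in>W. \<bar>agr d y x - ?D\<bar>)" by (intro sum_mono2) (use that in auto)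
    finally show ?thesis using sum_abs_dev_agr[OF that(1)] by linarith
  qed
  have "\<bar>(\<Sum>y\<in>?A. agr d y b) - real (card ?A) * ?D\<bar> \<le> real (card W) * real m ^ 3"
    by (intro dev b) auto
  moreover have "\<bar>(\<Sum>y\<in>?B. agr d y a) - real (card ?B) * ?D\<bar> \<le> real (card W) * real m ^ 3"
    by (intro dev a) auto
  ultimately have "real (card ?A) * ?D \<le> real (card ?B) * ?D + 2 * (real (card W) * real m ^ 3)"
    using exchange[OF a b ne, of P] by linarith
  also have "\<dots> = (real (card ?B) + 2 * real q * real (card W) / real m ^ 3) * ?D"
    unfolding d_eq_sq using m q_pos by (simp add: field_simps)
  finally show ?thesis
    by (rule mult_right_le_imp_le) (use m q_pos d_eq in simp)
qed

lemma card_shift: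
  assumes a: "a \<in> W" and b: "b \<in> W" and ne: "\<forall>i<d. a i \<noteq> b i"
  shows "real (card {y\<in>W. P (agr d y a - agr d y b)})
    \<le> real (card {y\<in>W. P (agr d y a - agr d y b - 2 * real k)}) + real k * (2 * real q * real (card W) / real m ^ 3)"
proof (induction k)
  case (Suc k)
  have "2 * real (Suc k) = 2 + 2 * real k" by simp
  then have "agr d y a - agr d y b - 2 - 2 * real k = agr d y a - agr d y b - 2 * real (Suc k)" for y by linarith
  moreover have "real (Suc k) * c = real k * c + c" for c by (simp add: algebra_simps)
  ultimately show ?case
    using Suc card_shift_two[OF a b ne, of "\<lambda>s. P (s - 2 * real k)"] by (simp only:)
qed simp

text \<open>The windows \<open>B k\<close> are disjoint translates of each other, so they have nearly equal sizes.\<close>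

lemma anticoncentration:
  assumes a: "a \<in> W" and b: "b \<in> W" and ne: "\<forall>i<d. a i \<noteq> b i"
  shows "real (card {y\<in>W. \<bar>agr d y a - agr d y b\<bar> \<le> 2 * real m ^ 2})
    \<le> (1 + 6 * real q) / real K * real (card W)"
proof -
  let ?S = "\<lambda>y. agr d y a - agr d y b" and ?N = "real (card W)"
  let ?C = "real (card {y\<in>W. \<bar>?S y\<bar> \<le> 2 * real m ^ 2})"
  \<comment> \<open>The windows are centred at \<open>2 * k * L\<close>, since
    \<open>card_shift\<close> moves in steps of two. Consecutive centres are
    \<open>4 * m ^ 2 + 2\<close> apart, just more than the window length
    \<open>4 * m ^ 2\<close>.\<close>
  define L where "L = 2 * m ^ 2 + 1"
  define B where "B k = {y\<in>W. \<bar>?S y - 2 * real (k * L)\<bar> \<le> 2 * real m ^ 2}" for k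
  have m: "real m > 0" using m_pos by simp
  have disj: "B k \<inter> B l = {}" if "k < l" for k l
  proof (rule ccontr)
    assume "B k \<inter> B l \<noteq> {}"
    then obtain y where "\<bar>?S y - 2 * real (k * L)\<bar> \<le> 2 * real m ^ 2" "\<bar>?S y - 2 * real (l * L)\<bar> \<le> 2 * real m ^ 2"
      by (auto simp: B_def)
    then have "2 * real (l * L) - 2 * real (k * L) \<le> 4 * real m ^ 2" by linarith
    moreover have "real ((k + 1) * L) \<le> real (l * L)"
      using that by (intro of_nat_mono mult_le_mono1) simp
    ultimately have "2 * real L \<le> 4 * real m ^ 2" by (simp add: algebra_simps)
    then show False by (simp add: L_def)
  qed
  have "\<forall>k\<in>{..<K}. \<forall>l\<in>{..<K}. k \<noteq> l \<longrightarrow> B k \<inter> B l = {}"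
    using disj by (metis Int_commute linorder_neqE_nat)
  then have "(\<Sum>k<K. card (B k)) = card (\<Union>k<K. B k)"
    by (intro card_UN_disjoint[symmetric]) (auto simp: B_def)
  also have "\<dots> \<le> card W" by (intro card_mono) (auto simp: B_def)
  finally have total: "(\<Sum>k<K. real (card (B k))) \<le> ?N" by (metis of_nat_mono of_nat_sum)
  \<comment> \<open>Moving the central window to the \<open>k\<close>-th one takes
    \<open>k * L\<close> double steps, fewer than \<open>3 * K * m ^ 2\<close>. Each costs
    \<open>2 * q * card W / m ^ 3\<close>, and \<open>K / m = 1 / K\<close> because \<open>m\<close>
    is the square of \<open>K\<close>.\<close>
  have step: "?C \<le> real (card (B k)) + 6 * real q * ?N / real K" if "k < K" for k
  proof -
    have "real (k * L) \<le> real (K * (3 * m\<^sup>2))"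
      using that m_pos unfolding L_def by (intro of_nat_mono mult_le_mono) auto
    then have "real (k * L) * (2 * real q * ?N / real m ^ 3) \<le> real (K * (3 * m\<^sup>2)) * (2 * real q * ?N / real m ^ 3)"
      by (rule mult_right_mono) simp
    also have "\<dots> = 6 * real q * ?N * (real K / real m)"
      using m by (simp add: power2_eq_square power3_eq_cube)
    also have "real K / real m = 1 / real K"
      using K_pos by (simp add: m_eq power2_eq_square)
    also have "6 * real q * ?N * (1 / real K) = 6 * real q * ?N / real K" by simp
    finally show ?thesis
      using card_shift[OF a b ne, of "\<lambda>s. \<bar>s\<bar> \<le> 2 * real m ^ 2" "k * L"] unfolding B_def by linarith
  qed
  have "real K * ?C = (\<Sum>k<K. ?C)" by simp
  also have "\<dots> \<le> (\<Sum>k<K. real (card (B k)) + 6 * real q * ?N / real K)"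
    by (intro sum_mono step) simp
  also have "\<dots> \<le> (1 + 6 * real q) * ?N"
    using total K_pos by (simp add: sum.distrib algebra_simps)
  finally show ?thesis using K_pos by (simp add: field_simps)
qed

subsection \<open>Isoperimetry\<close>

text \<open>The Hamming distance \<open>f\<close> to \<open>U\<close> changes by at most one per
  letter, so its variance is at most \<open>d\<close>. It vanishes on \<open>U\<close>, whose points
  thus all deviate by the full mean; since \<open>U\<close> has density at least
  \<open>\<delta>\<close>, the mean is at most \<open>c * m ^ 3\<close>.\<close>

lemma orbit_near_dense_set:
  assumes U: "U \<subseteq> W" "\<delta> * real (card W) \<le> real (card U)" and "0 < \<delta>" "0 \<le> c" "1 \<le> c\<^sup>2 * \<delta>"
  obtains x u where "x \<in> W" "\<And>k. k < q \<Longrightarrow> u k \<in> U"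
    "\<And>k. k < q \<Longrightarrow> real d - agr d (u k) (sh k x) \<le> real q * c * real m ^ 3"
proof -
  have finU: "finite U" using U(1) finite_W by (rule finite_subset)
  have "0 < real (card U)"
    using assms(2,3) card_W_pos by (meson less_le_trans mult_pos_pos)
  then have "U \<noteq> {}" by auto
  define f where "f x = Min ((\<lambda>u. real d - agr d u x) ` U)" for x
  have f_le: "f x \<le> real d - agr d u x" if "u \<in> U" for x u
    unfolding f_def using that finU by auto
  have f_ex: "\<exists>u\<in>U. f x = real d - agr d u x" for x
  proof -
    have "f x \<in> (\<lambda>u. real d - agr d u x) ` U"
      unfolding f_def using finU \<open>U \<noteq> {}\<close> by (intro Min_in) auto
    then show ?thesis by blast
  qed
  have f_nonneg: "0 \<le> f x" for x
  proof -
    have "agr d u x \<le> (\<Sum>i<d. 1)" for u unfolding agr_def by (rule sum_mono) simp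
    then show ?thesis using f_ex[of x] by auto
  qed
  have f_le_Suc: "f (x(i := a)) \<le> f x + 1" if "i < d" for x i a
  proof -
    obtain u where "u \<in> U" "f x = real d - agr d u x" using f_ex by blast
    moreover have "agr d u (x(i := a)) \<ge> agr d u x - 1"
      using that by (simp add: agr_commute[of d u] agr_fun_upd)
    ultimately show ?thesis using f_le[of u "x(i := a)"] by linarith
  qed
  \<comment> \<open>The second inequality is the first one applied to the update that restores the
    old letter.\<close>
  have lip: "\<bar>f (x(i := a)) - f x\<bar> \<le> 1" if "i < d" for x i a
    using f_le_Suc[OF that, of x a] f_le_Suc[OF that, of "x(i := a)" "x i"] by simp
  let ?M = "mean W f"
  have var: "(\<Sum>x\<in>W. (f x - ?M)\<^sup>2) \<le> real (card W) * (\<Sum>i<d. 1\<^sup>2)"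
    by (rule variance_W) (use lip in simp)
  have "f x = 0" if "x \<in> U" for x
    using f_le[OF that, of x] f_nonneg[of x] by simp
  then have "real (card U) * ?M\<^sup>2 = (\<Sum>x\<in>U. (f x - ?M)\<^sup>2)" by simp
  also have "\<dots> \<le> (\<Sum>x\<in>W. (f x - ?M)\<^sup>2)" by (intro sum_mono2 U finite_W) simp
  also note var
  finally have "real (card U) * ?M\<^sup>2 \<le> real (card W) * real d" by simp
  moreover have "\<delta> * real (card W) * ?M\<^sup>2 \<le> real (card U) * ?M\<^sup>2"
    using U(2) by (rule mult_right_mono) simp
  ultimately have "real (card W) * (\<delta> * ?M\<^sup>2) \<le> real (card W) * real d" by (simp add: mult_ac)
  then have dM: "\<delta> * ?M\<^sup>2 \<le> real d" using card_W_pos by simp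
  have "?M\<^sup>2 \<le> (c\<^sup>2 * \<delta>) * ?M\<^sup>2" using mult_right_mono[OF assms(5), of "?M\<^sup>2"] by simp
  also have "\<dots> = c\<^sup>2 * (\<delta> * ?M\<^sup>2)" by simp
  also have "\<dots> \<le> c\<^sup>2 * real d" using dM by (intro mult_left_mono) auto
  also have "\<dots> = (c * real m ^ 3)\<^sup>2" by (simp add: d_eq power_mult_distrib power_mult[symmetric])
  finally have M: "?M \<le> c * real m ^ 3" by (rule power2_le_imp_le) (simp add: assms)
  \<comment> \<open>Shifts permute \<open>W\<close>, so the sum of \<open>f\<close> over an orbit
    has average \<open>q * ?M\<close>, and some orbit does not exceed it. Since \<open>f\<close> is
    nonnegative, that sum bounds each of its terms.\<close>
  have "\<exists>x\<in>W. (\<Sum>k<q. f (sh k x)) \<le> real q * ?M"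
  proof (rule ccontr)
    assume "\<not> ?thesis"
    then have "(\<Sum>x\<in>W. real q * ?M) < (\<Sum>x\<in>W. \<Sum>k<q. f (sh k x))"
      using W_nonempty by (intro sum_strict_mono) auto
    also have "\<dots> = (\<Sum>k<q. \<Sum>x\<in>W. f (sh k x))" by (rule sum.swap)
    also have "\<dots> = real q * (real (card W) * ?M)" unfolding sum_sh by (simp add: sum_eq_card_mean)
    finally show False by simp
  qed
  then obtain x where x: "x \<in> W" "(\<Sum>k<q. f (sh k x)) \<le> real q * ?M" by blast
  have near: "f (sh k x) \<le> real q * c * real m ^ 3" if "k < q" for k
  proof -
    have "f (sh k x) \<le> (\<Sum>k<q. f (sh k x))"
      using that f_nonneg by (intro member_le_sum) auto
    also have "\<dots> \<le> real q * (c * real m ^ 3)"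
      using x(2) M by (meson mult_left_mono of_nat_0_le_iff order_trans)
    finally show ?thesis by (simp add: mult.assoc)
  qed
  obtain u where "\<And>k. u k \<in> U" "\<And>k. f (sh k x) = real d - agr d (u k) (sh k x)"
    using f_ex[of "sh _ x"] by metis
  then show ?thesis using near x(1) by (intro that[of x u]) auto
qed

end

subsection \<open>The majority graph on words\<close>

context words
begin

text \<open>The \<open>p\<close> shifts of \<open>x\<close> that agree best with \<open>y\<close> are the neighbours of \<open>y\<close> in the orbit of \<open>x\<close>.\<close>

definition adj :: "nat \<Rightarrow> (nat \<Rightarrow> nat) \<Rightarrow> (nat \<Rightarrow> nat) \<Rightarrow> bool" where
  "adj p x y \<longleftrightarrow> card {j\<in>{..<q}. agr d y x < agr d y (sh j x)} < p"

text \<open>The agreement of \<open>y\<close> with \<open>sh j x\<close> equals that of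
  \<open>x\<close> with the shift of \<open>y\<close> by \<open>-j\<close>, so negation of exponents
  matches the two sets being counted.\<close>

lemma adj_sym:
  assumes "x \<in> W" "y \<in> W" "adj p x y"
  shows "adj p y x"
proof -
  \<comment> \<open>Negation modulo \<open>q\<close>; the outer \<open>mod\<close> sends
    \<open>0\<close> to \<open>0\<close>.\<close>
  define r where "r j = (q - j) mod q" for j
  have r_lt: "r j < q" for j using q_pos by (simp add: r_def)
  have r_r: "r (r j) = j" if "j < q" for j
    using that by (cases "j = 0") (auto simp: r_def)
  have agr_r: "agr d x (sh (r j) y) = agr d y (sh j x)" if "j < q" for j
  proof -
    have "agr d y (sh j x) = agr d (sh (q - j) y) (sh (q - j) (sh j x))"
      using assms by (simp add: agr_sh_sh)
    also have "sh (q - j) (sh j x) = x"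
      using that assms by (simp add: sh_sh sh_q)
    finally show ?thesis by (simp add: r_def sh_mod agr_commute)
  qed
  have "bij_betw r {j\<in>{..<q}. agr d y x < agr d y (sh j x)} {j\<in>{..<q}. agr d x y < agr d x (sh j y)}"
  proof (rule bij_betw_byWitness[where f' = r])
    show "r ` {j\<in>{..<q}. agr d y x < agr d y (sh j x)} \<subseteq> {j\<in>{..<q}. agr d x y < agr d x (sh j y)}"
      by (auto simp: agr_r r_lt agr_commute[of d x y])
    show "r ` {j\<in>{..<q}. agr d x y < agr d x (sh j y)} \<subseteq> {j\<in>{..<q}. agr d y x < agr d y (sh j x)}"
    proof (rule image_subsetI)
      fix j assume j: "j \<in> {j\<in>{..<q}. agr d x y < agr d x (sh j y)}"
      then have "agr d y (sh (r j) x) = agr d x (sh j y)"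
        using agr_r[of "r j"] by (simp add: r_lt r_r)
      then show "r j \<in> {j\<in>{..<q}. agr d y x < agr d y (sh j x)}"
        using j by (simp add: r_lt agr_commute[of d y x])
    qed
  qed (auto simp: r_r)
  then show ?thesis
    using assms(3) by (simp add: adj_def bij_betw_same_card)
qed

text \<open>Adjacency of \<open>u k\<close> is decided by comparison with its own shifts, not with
  the other \<open>u l\<close>; hence \<open>dev\<close> speaks of all shifts of each
  \<open>u k\<close>. Under \<open>gap\<close> and \<open>dev\<close> these comparisons have the
  same outcome as those among the shifts of \<open>x\<close>, so \<open>u k\<close> inherits the
  rank of \<open>sh k x\<close> and \<open>card_top_ranks\<close> applies.\<close>

lemma card_adj_orbit:
  assumes p: "p \<le> q" and y: "y \<in> W" and u: "\<And>k. k < q \<Longrightarrow> u k \<in> W"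
    and gap: "\<And>k l. k < q \<Longrightarrow> l < q \<Longrightarrow> k \<noteq> l \<Longrightarrow> 2 * g < \<bar>agr d y (sh k x) - agr d y (sh l x)\<bar>"
    and dev: "\<And>k j. k < q \<Longrightarrow> j < q \<Longrightarrow> \<bar>agr d y (sh j (u k)) - agr d y (sh (k + j) x)\<bar> < g"
  shows "inj_on u {..<q}" and "card {k\<in>{..<q}. adj p (u k) y} = p"
proof -
  define a where "a l = agr d y (sh l x)" for l
  have "0 < g" using dev[OF q_pos q_pos] by linarith
  have gap': "2 * g < \<bar>a k - a l\<bar>" if "k < q" "l < q" "k \<noteq> l" for k l
    using gap[OF that] by (simp add: a_def)
  have dev': "\<bar>agr d y (sh j (u k)) - a ((k + j) mod q)\<bar> < g" if "k < q" "j < q" for k j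
    using dev[OF that] by (simp add: a_def sh_mod)
  have dev0: "\<bar>agr d y (u k) - a k\<bar> < g" if "k < q" for k
    using dev'[OF that q_pos] that u[OF that] by (simp add: sh_0)
  have inj_a: "inj_on a {..<q}"
    using gap' \<open>0 < g\<close> by (intro inj_onI) force
  show "inj_on u {..<q}"
  proof (rule inj_onI)
    fix k l assume "k \<in> {..<q}" "l \<in> {..<q}" "u k = u l"
    then show "k = l" using gap'[of k l] dev0[of k] dev0[of l] by fastforce
  qed
  have adj_iff: "adj p (u k) y \<longleftrightarrow> card {l\<in>{..<q}. a k < a l} < p" if k: "k < q" for k
  proof -
    let ?t = "\<lambda>j. (k + j) mod q"
    \<comment> \<open>A gap above \<open>2 * g\<close> outweighs two deviations below
      \<open>g\<close>, so the order is preserved. If the rotated index is \<open>k\<close> itself,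
      then \<open>j = 0\<close> and both sides are false.\<close>
    have cmp: "agr d y (u k) < agr d y (sh j (u k)) \<longleftrightarrow> a k < a (?t j)" if j: "j < q" for j
    proof (cases "?t j = k")
      case True
      then have "j = 0"
        using k j by (metis add_0_right cong_def cong_add_lcancel_nat mod_less q_pos)
      then show ?thesis using k u[OF k] by (simp add: sh_0)
    next
      case False
      then show ?thesis
        using gap'[of k "?t j"] dev'[OF k j] dev0[OF k] k q_pos by fastforce
    qed
    have inj: "inj_on ?t {..<q}"
      by (rule inj_onI) (metis cong_def cong_add_lcancel_nat lessThan_iff mod_less)
    have surj: "?t ` {..<q} = {..<q}"
      by (rule endo_inj_surj) (use inj q_pos in auto)
    have "?t ` {j\<in>{..<q}. a k < a (?t j)} = {l\<in>?t ` {..<q}. a k < a l}"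
      by blast
    then have img: "?t ` {j\<in>{..<q}. a k < a (?t j)} = {l\<in>{..<q}. a k < a l}"
      unfolding surj .
    have "inj_on ?t {j\<in>{..<q}. a k < a (?t j)}"
      using inj by (rule inj_on_subset) auto
    from card_image[OF this] have "card {j\<in>{..<q}. a k < a (?t j)} = card {l\<in>{..<q}. a k < a l}"
      unfolding img by (rule sym)
    moreover have "{j\<in>{..<q}. agr d y (u k) < agr d y (sh j (u k))} = {j\<in>{..<q}. a k < a (?t j)}"
      using cmp by auto
    ultimately show ?thesis unfolding adj_def by simp
  qed
  have "{k\<in>{..<q}. adj p (u k) y} = {k\<in>{..<q}. card {l\<in>{..<q}. a k < a l} < p}"
    using adj_iff by auto
  then show "card {k\<in>{..<q}. adj p (u k) y} = p"
    using card_top_ranks[of "{..<q}" a p] inj_a p by simp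
qed

section \<open>Exceptional words and degrees in the word graph\<close>

lemma adj_sh_sh:
  assumes "x \<in> W" "y \<in> W"
  shows "adj p (sh k x) (sh k y) \<longleftrightarrow> adj p x y"
proof -
  have "sh j (sh k x) = sh k (sh j x)" for j by (simp add: sh_sh add.commute)
  then show ?thesis using assms by (simp add: adj_def agr_sh_sh)
qed

text \<open>Words outside \<open>ties (2 * g) x\<close> and outside \<open>deviant g x u\<close> are
  those that satisfy the hypotheses \<open>gap\<close> and \<open>dev\<close> of
  \<open>card_adj_orbit\<close>.\<close>

definition ties :: "real \<Rightarrow> (nat \<Rightarrow> nat) \<Rightarrow> (nat \<Rightarrow> nat) set" where
  "ties g x = {y\<in>W. \<exists>k<q. \<exists>l<q. k \<noteq> l \<and> \<bar>agr d y (sh k x) - agr d y (sh l x)\<bar> \<le> g}"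

definition deviant :: "real \<Rightarrow> (nat \<Rightarrow> nat) \<Rightarrow> (nat \<Rightarrow> nat \<Rightarrow> nat) \<Rightarrow> (nat \<Rightarrow> nat) set" where
  "deviant g x u = {y\<in>W. \<exists>k<q. \<exists>j<q. g \<le> \<bar>agr d y (sh j (u k)) - agr d y (sh (k + j) x)\<bar>}"

text \<open>Degrees are constant along an orbit, so \<open>q\<close> times the degree counts
  adjacent pairs of a shift of \<open>x\<close> and a word \<open>y\<close>. An untied
  \<open>y\<close> contributes exactly \<open>p\<close> pairs, and a tied one is off by at most
  \<open>q\<close>.\<close>

lemma degree_adj:
  assumes p: "p \<le> q" and x: "x \<in> W" and g: "0 < g"
  shows "\<bar>real (card {y\<in>W. adj p x y}) - real p / real q * real (card W)\<bar> \<le> real (card (ties (2 * g) x))"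
proof -
  let ?deg = "\<lambda>x. real (card {y\<in>W. adj p x y})"
  let ?c = "\<lambda>y. real (card {k\<in>{..<q}. adj p (sh k x) y})"
  have "?deg (sh k x) = ?deg x" for k
  proof -
    have "card {y\<in>W. adj p (sh k x) y} = card {y\<in>W. adj p (sh k x) (sh k y)}"
      by (rule card_sh[symmetric])
    also have "{y\<in>W. adj p (sh k x) (sh k y)} = {y\<in>W. adj p x y}"
      using x by (auto simp: adj_sh_sh)
    finally show ?thesis by simp
  qed
  then have "real q * ?deg x = (\<Sum>k<q. ?deg (sh k x))" by simp
  also have "\<dots> = (\<Sum>k<q. \<Sum>y\<in>W. of_bool (adj p (sh k x) y))"
    by (intro sum.cong refl card_filter_eq_sum finite_W)
  also have "\<dots> = (\<Sum>y\<in>W. \<Sum>k<q. of_bool (adj p (sh k x) y))" by (rule sum.swap)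
  also have "\<dots> = (\<Sum>y\<in>W. ?c y)"
    by (intro sum.cong refl card_filter_eq_sum[symmetric] finite_lessThan)
  finally have "\<bar>real q * ?deg x - real p * real (card W)\<bar> = \<bar>\<Sum>y\<in>W. ?c y - real p\<bar>"
    by (simp only: sum_subtractf sum_constant mult.commute[of "real p"])
  also have "\<dots> \<le> (\<Sum>y\<in>W. \<bar>?c y - real p\<bar>)" by (rule sum_abs)
  also have "\<dots> \<le> (\<Sum>y\<in>W. real q * of_bool (y \<in> ties (2 * g) x))"
  proof (rule sum_mono)
    fix y assume y: "y \<in> W"
    show "\<bar>?c y - real p\<bar> \<le> real q * of_bool (y \<in> ties (2 * g) x)"
    proof (cases "y \<in> ties (2 * g) x")
      case True
      have "card {k\<in>{..<q}. adj p (sh k x) y} \<le> card {..<q}" by (rule card_mono) auto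
      then show ?thesis using True p by simp
    next
      case False
      have "card {k\<in>{..<q}. adj p (sh k x) y} = p"
        \<comment> \<open>Here \<open>u\<close> is the orbit itself, so all deviations are zero and
          any positive \<open>g\<close> serves.\<close>
        by (rule card_adj_orbit(2)[OF p y, where g = g and x = x])
          (use False y g in \<open>auto simp: ties_def sh_sh not_le\<close>)
      then show ?thesis by simp
    qed
  qed
  also have "\<dots> = real q * real (card (W \<inter> ties (2 * g) x))"
    by (simp add: sum_distrib_left[symmetric])
  also have "W \<inter> ties (2 * g) x = ties (2 * g) x" by (auto simp: ties_def)
  finally have "\<bar>real q * (?deg x - real p / real q * real (card W))\<bar> \<le> real q * real (card (ties (2 * g) x))"
    using q_pos by (simp add: right_diff_distrib)
  then show ?thesis using q_pos by (simp add: abs_mult)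
qed

end

section \<open>Exceptional words are rare\<close>

context scaled_words
begin

text \<open>Two distinct shifts of a word differ in every coordinate, as
  \<open>anticoncentration\<close> demands; a union bound over pairs of shifts follows.\<close>

lemma card_ties:
  assumes x: "x \<in> W"
  shows "real (card (ties (2 * real m ^ 2) x)) \<le> real q ^ 2 * ((1 + 6 * real q) / real K * real (card W))"
proof -
  define B where "B k l = (if k = l then {} else {y\<in>W. \<bar>agr d y (sh k x) - agr d y (sh l x)\<bar> \<le> 2 * real m ^ 2})" for k l
  have "ties (2 * real m ^ 2) x = (\<Union>k<q. \<Union>l<q. B k l)"
    by (auto simp: ties_def B_def split: if_splits)
  moreover have "real (card (\<Union>k<q. \<Union>l<q. B k l)) \<le> real q ^ 2 * ((1 + 6 * real q) / real K * real (card W))"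
  proof (rule card_square_UN_le)
    fix k l assume kl: "k < q" "l < q"
    show "real (card (B k l)) \<le> (1 + 6 * real q) / real K * real (card W)"
    proof (cases "k = l")
      case False
      have "sh k x i \<noteq> sh l x i" if "i < d" for i
        using False kl that by (simp add: sh_apply) (metis cong_def cong_add_lcancel_nat mod_less)
      then show ?thesis
        using anticoncentration[of "sh k x" "sh l x"] False by (simp add: B_def)
    qed (simp add: B_def)
  qed
  ultimately show ?thesis by simp
qed

text \<open>A common shift preserves the distance of \<open>u k\<close> to \<open>sh k x\<close>, so
  each difference has mean square at most \<open>4 * t * m ^ 3\<close>. Chebyshev at the threshold
  \<open>m ^ 2\<close> leaves a fraction \<open>4 * t / m\<close>.\<close>

lemma card_deviant:
  assumes x: "x \<in> W" and u: "\<And>k. k < q \<Longrightarrow> u k \<in> W"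
    and near: "\<And>k. k < q \<Longrightarrow> real d - agr d (u k) (sh k x) \<le> t * real m ^ 3"
  shows "real (card (deviant (real m ^ 2) x u)) \<le> real q ^ 2 * (4 * t / real m * real (card W))"
proof -
  define B where "B k j = {y\<in>W. real m ^ 2 \<le> \<bar>(agr d y (sh j (u k)) - agr d y (sh (k + j) x)) - 0\<bar>}" for k j
  have m: "real m > 0" using m_pos by simp
  have "deviant (real m ^ 2) x u = (\<Union>k<q. \<Union>j<q. B k j)"
    by (auto simp: deviant_def B_def)
  moreover have "real (card (\<Union>k<q. \<Union>j<q. B k j)) \<le> real q ^ 2 * (4 * t / real m * real (card W))"
  proof (rule card_square_UN_le)
    fix k j assume kj: "k < q" "j < q"
    have "agr d (sh j (u k)) (sh (k + j) x) = agr d (u k) (sh k x)"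
      unfolding sh_sh[symmetric] using u[OF kj(1)] by (simp add: agr_sh_sh)
    then have "(\<Sum>y\<in>W. ((agr d y (sh j (u k)) - agr d y (sh (k + j) x)) - 0)\<^sup>2)
        \<le> real (card W) * (4 * (real d - agr d (u k) (sh k x)))"
      using variance_agr_diff[of "sh j (u k)" "sh (k + j) x"] by simp
    also have "\<dots> \<le> real (card W) * (4 * (t * real m ^ 3))"
      using near[OF kj(1)] by (intro mult_left_mono) auto
    finally have "real (card (B k j)) \<le> real (card W) * (4 * (t * real m ^ 3)) / (real m ^ 2)\<^sup>2"
      unfolding B_def using m by (intro chebyshev_card) auto
    also have "\<dots> = 4 * t / real m * real (card W)"
      using m by (simp add: power2_eq_square power3_eq_cube)
    finally show "real (card (B k j)) \<le> 4 * t / real m * real (card W)" .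
  qed
  ultimately show ?thesis by simp
qed

end

text \<open>A word outside \<open>B\<close> is adjacent to exactly \<open>p\<close> of the
  \<open>u k\<close>, so it cannot be a common neighbor of \<open>p + 1\<close> of them. That
  \<open>B\<close> is not all of \<open>W\<close> provides one such word, which is enough to make
  \<open>u\<close> injective.\<close>

lemma (in scaled_words) orbit_few_common_neighbors:
  assumes p: "p \<le> q" and x: "x \<in> W" and u: "\<forall>k<q. u k \<in> W"
    and bad: "ties (2 * real m ^ 2) x \<union> deviant (real m ^ 2) x u = B" and proper: "card B < card W"
  shows "card (u ` {..<q}) = q"
    and "\<And>S. S \<subseteq> u ` {..<q} \<Longrightarrow> card S = p + 1 \<Longrightarrow> {y\<in>W. \<forall>v\<in>S. adj p v y} \<subseteq> B"
proof -
  have good: "inj_on u {..<q}" "card {k\<in>{..<q}. adj p (u k) y} = p" if y: "y \<in> W" "y \<notin> B" for y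
  proof -
    have uW: "u k \<in> W" if "k < q" for k using u that by blast
    have y': "y \<notin> ties (2 * real m ^ 2) x" "y \<notin> deviant (real m ^ 2) x u"
      using y(2) bad by blast+
    have gap: "2 * real m ^ 2 < \<bar>agr d y (sh k x) - agr d y (sh l x)\<bar>" if "k < q" "l < q" "k \<noteq> l" for k l
      using that y(1) y'(1) unfolding ties_def mem_Collect_eq by (meson linorder_not_le)
    have dev: "\<bar>agr d y (sh j (u k)) - agr d y (sh (k + j) x)\<bar> < real m ^ 2" if "k < q" "j < q" for k j
      using that y(1) y'(2) unfolding deviant_def mem_Collect_eq by (meson linorder_not_le)
    show "inj_on u {..<q}"
      by (rule card_adj_orbit(1)[where g = "real m ^ 2" and x = x, OF p y(1) uW gap dev])
    show "card {k\<in>{..<q}. adj p (u k) y} = p"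
      by (rule card_adj_orbit(2)[where g = "real m ^ 2" and x = x, OF p y(1) uW gap dev])
  qed
  have "B \<subseteq> W" using bad by (auto simp: ties_def deviant_def)
  moreover have "B \<noteq> W" using proper by auto
  ultimately obtain y0 where "y0 \<in> W" "y0 \<notin> B" by blast
  then have inj: "inj_on u {..<q}" by (rule good)
  then show "card (u ` {..<q}) = q" by (simp add: card_image)
  fix S assume S: "S \<subseteq> u ` {..<q}" "card S = p + 1"
  show "{y\<in>W. \<forall>v\<in>S. adj p v y} \<subseteq> B"
  proof (rule subsetI, rule ccontr)
    fix y assume y: "y \<in> {y\<in>W. \<forall>v\<in>S. adj p v y}" and "y \<notin> B"
    obtain T where T: "T \<subseteq> {..<q}" "S = u ` T" using S(1) by (auto simp: subset_image_iff)
    have "card T = p + 1"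
      using S(2) card_image[OF inj_on_subset[OF inj T(1)]] T(2) by simp
    moreover have "card T \<le> card {k\<in>{..<q}. adj p (u k) y}"
      using T y by (intro card_mono) auto
    ultimately show False using good(2)[of y] y \<open>y \<notin> B\<close> by simp
  qed
qed

text \<open>All error terms are of order \<open>1 / K\<close> with constants depending only on
  \<open>q\<close> and \<open>\<delta>\<close>, so a large \<open>K\<close> meets every
  requirement.\<close>

theorem exists_word_graph:
  fixes p q :: nat and \<delta> \<eta> :: real
  assumes "0 < q" "p \<le> q" "0 < \<delta>" "0 < \<eta>"
  obtains \<Omega> :: "(nat \<Rightarrow> nat) set" and R where "finite \<Omega>" "\<Omega> \<noteq> {}"
    "\<And>x y. x \<in> \<Omega> \<Longrightarrow> y \<in> \<Omega> \<Longrightarrow> R x y \<Longrightarrow> R y x"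
    "\<And>x. x \<in> \<Omega> \<Longrightarrow> \<bar>real (card {y\<in>\<Omega>. R x y}) - real p / real q * real (card \<Omega>)\<bar> \<le> \<eta> * real (card \<Omega>)"
    "\<And>U. U \<subseteq> \<Omega> \<Longrightarrow> \<delta> * real (card \<Omega>) \<le> real (card U) \<Longrightarrow>
      \<exists>Q\<subseteq>U. card Q = q \<and> (\<forall>S\<subseteq>Q. card S = p + 1 \<longrightarrow>
        real (card {y\<in>\<Omega>. \<forall>x\<in>S. R x y}) \<le> \<eta> * real (card \<Omega>))"
proof -
  define c where "c = sqrt (1 / \<delta>)"
  have c: "0 \<le> c" "1 \<le> c\<^sup>2 * \<delta>" using \<open>0 < \<delta>\<close> by (simp_all add: c_def)
  \<comment> \<open>The sum of the constants in \<open>card_ties\<close> and in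
    \<open>card_deviant\<close> with \<open>t = q * c\<close>. Then \<open>K > C\<close> keeps the
    exceptional set proper, and \<open>K > C / \<eta>\<close> keeps it below the allowed
    error.\<close>
  define C where "C = real q ^ 2 * (1 + 6 * real q) + real q ^ 2 * (4 * (real q * c))"
  obtain K :: nat where K: "max (max C (C / \<eta>)) 0 < real K" using reals_Archimedean2 by blast
  then have K_pos: "0 < K" by simp
  have CK: "C / real K < 1" "C / real K \<le> \<eta>"
    using K K_pos \<open>0 < \<eta>\<close> by (simp_all add: field_simps)
  define m where "m = K\<^sup>2"
  interpret scaled_words "m ^ 6" q m K
    by standard (simp_all add: \<open>0 < q\<close> K_pos m_def)
  let ?N = "real (card W)"
  have inv_m: "1 / real m \<le> 1 / real K"
    using K_pos by (simp add: m_def field_simps power2_eq_square)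
  have ties_le: "real (card (ties (2 * real m ^ 2) x)) \<le> real q ^ 2 * (1 + 6 * real q) / real K * ?N"
    if "x \<in> W" for x
    using card_ties[OF that] by simp
  have tail_nonneg: "0 \<le> real q ^ 2 * (4 * (real q * c)) / real K * ?N" using c(1) by simp
  have C_split: "C / real K * ?N = real q ^ 2 * (1 + 6 * real q) / real K * ?N + real q ^ 2 * (4 * (real q * c)) / real K * ?N"
    by (simp add: C_def add_divide_distrib distrib_right)
  have eta: "C / real K * ?N \<le> \<eta> * ?N" using CK(2) by (rule mult_right_mono) simp
  show ?thesis
  proof (rule that[of W "adj p"])
    fix x assume x: "x \<in> W"
    have "\<bar>real (card {y\<in>W. adj p x y}) - real p / real q * ?N\<bar> \<le> real (card (ties (2 * real m ^ 2) x))"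
      using m_pos by (intro degree_adj assms x) simp
    then show "\<bar>real (card {y\<in>W. adj p x y}) - real p / real q * ?N\<bar> \<le> \<eta> * ?N"
      using ties_le[OF x] C_split eta tail_nonneg by linarith
  next
    fix U assume U: "U \<subseteq> W" "\<delta> * ?N \<le> real (card U)"
    obtain x u where x: "x \<in> W" and uU: "\<And>k. k < q \<Longrightarrow> u k \<in> U"
      and near: "\<And>k. k < q \<Longrightarrow> real (m ^ 6) - agr (m ^ 6) (u k) (sh k x) \<le> real q * c * real m ^ 3"
      using orbit_near_dense_set[OF U \<open>0 < \<delta>\<close> c] by metis
    have u: "\<forall>k<q. u k \<in> W" using uU U(1) by blast
    define B where "B = ties (2 * real m ^ 2) x \<union> deviant (real m ^ 2) x u"
    have "real (card (deviant (real m ^ 2) x u)) \<le> real q ^ 2 * (4 * (real q * c) / real m * ?N)"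
      by (rule card_deviant[OF x _ near]) (use u in auto)
    also have "\<dots> = real q ^ 2 * (4 * (real q * c)) * ?N * (1 / real m)" by simp
    also have "\<dots> \<le> real q ^ 2 * (4 * (real q * c)) * ?N * (1 / real K)"
      using c(1) by (intro mult_left_mono inv_m) simp
    also have "\<dots> = real q ^ 2 * (4 * (real q * c)) / real K * ?N" by simp
    finally have dev: "real (card (deviant (real m ^ 2) x u)) \<le> \<dots>" .
    have "real (card B) \<le> real (card (ties (2 * real m ^ 2) x)) + real (card (deviant (real m ^ 2) x u))"
      unfolding B_def of_nat_add[symmetric] by (intro of_nat_mono card_Un_le)
    then have B: "real (card B) \<le> C / real K * ?N"
      using ties_le[OF x] dev C_split by linarith
    also have "\<dots> < 1 * ?N" by (intro mult_strict_right_mono CK card_W_pos)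
    finally have "card B < card W" by simp
    note few = orbit_few_common_neighbors[OF \<open>p \<le> q\<close> x u B_def[symmetric] this]
    have "finite B" unfolding B_def ties_def deviant_def by simp
    show "\<exists>Q\<subseteq>U. card Q = q \<and> (\<forall>S\<subseteq>Q. card S = p + 1 \<longrightarrow>
        real (card {y\<in>W. \<forall>x\<in>S. adj p x y}) \<le> \<eta> * ?N)"
    proof (intro exI[of _ "u ` {..<q}"] conjI allI impI)
      fix S assume S: "S \<subseteq> u ` {..<q}" "card S = p + 1"
      have "card {y\<in>W. \<forall>x\<in>S. adj p x y} \<le> card B"
        by (rule card_mono[OF \<open>finite B\<close> few(2)[OF S]])
      then have "real (card {y\<in>W. \<forall>x\<in>S. adj p x y}) \<le> real (card B)" by (rule of_nat_mono)
      then show "real (card {y\<in>W. \<forall>x\<in>S. adj p x y}) \<le> \<eta> * ?N"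
        using B eta by linarith
    qed (use uU few(1) in auto)
  qed (use W_nonempty adj_sym in auto)
qed

section \<open>Blow-ups\<close>

lemma card_residue_class:
  fixes N r n :: nat
  assumes "r < N"
  shows "n div N \<le> card {v\<in>{..<n}. v mod N = r}" and "card {v\<in>{..<n}. v mod N = r} \<le> n div N + 1"
proof -
  let ?A = "{v\<in>{..<n}. v mod N = r}"
  have "(\<lambda>i. i * N + r) ` {..<n div N} \<subseteq> ?A"
  proof (rule image_subsetI)
    fix i assume "i \<in> {..<n div N}"
    then have "(i + 1) * N \<le> n div N * N" by (intro mult_le_mono1) simp
    also have "\<dots> \<le> n" by (rule div_times_less_eq_dividend)
    finally show "i * N + r \<in> ?A" using assms by simp
  qed
  then have "card ((\<lambda>i. i * N + r) ` {..<n div N}) \<le> card ?A"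
    by (intro card_mono) auto
  moreover have "inj_on (\<lambda>i. i * N + r) {..<n div N}"
    using assms by (intro inj_onI) simp
  ultimately show "n div N \<le> card ?A" by (simp add: card_image)
  have "inj_on (\<lambda>v. v div N) ?A"
    by (rule inj_onI) (metis (mono_tags, lifting) div_mult_mod_eq mem_Collect_eq)
  moreover have "(\<lambda>v. v div N) ` ?A \<subseteq> {..n div N}"
    by (auto intro: div_le_mono)
  ultimately have "card ?A \<le> card {..n div N}"
    by (metis card_image card_mono finite_atMost)
  then show "card ?A \<le> n div N + 1" by simp
qed

text \<open>Vertex \<open>v\<close> is a copy of the element \<open>e (v mod N)\<close>, so every
  element of \<open>\<Omega>\<close> has \<open>n / N\<close> copies up to an error of one.\<close>

lemma card_blowup:
  fixes e :: "nat \<Rightarrow> 'a"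
  assumes e: "bij_betw e {..<N} \<Omega>" and T: "T \<subseteq> \<Omega>" and N: "0 < N"
  shows "real (card {v\<in>{..<n}. e (v mod N) \<in> T}) \<le> (real n / real N + 1) * real (card T)"
    and "(real n / real N - 1) * real (card T) \<le> real (card {v\<in>{..<n}. e (v mod N) \<in> T})"
proof -
  let ?T' = "{r\<in>{..<N}. e r \<in> T}"
  let ?A = "\<lambda>r. {v\<in>{..<n}. v mod N = r}"
  have card_T': "card ?T' = card T"
  proof (rule bij_betw_same_card)
    have "e ` ?T' = T"
    proof -
      have "e ` ?T' = {y\<in>e ` {..<N}. y \<in> T}" by blast
      then show ?thesis using T bij_betw_imp_surj_on[OF e] by auto
    qed
    moreover have "inj_on e ?T'"
      using bij_betw_imp_inj_on[OF e] by (rule inj_on_subset) auto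
    ultimately show "bij_betw e ?T' T" by (simp add: bij_betw_def)
  qed
  have "{v\<in>{..<n}. e (v mod N) \<in> T} = (\<Union>r\<in>?T'. ?A r)" using N by auto
  also have "card \<dots> = (\<Sum>r\<in>?T'. card (?A r))"
    by (rule card_UN_disjoint) auto
  finally have sum: "real (card {v\<in>{..<n}. e (v mod N) \<in> T}) = (\<Sum>r\<in>?T'. real (card (?A r)))"
    by simp
  have "n < (n div N + 1) * N" using dividend_less_div_times[OF N, of n] by simp
  then have "real n < (real (n div N) + 1) * real N" by (metis of_nat_1 of_nat_add of_nat_less_iff of_nat_mult)
  then have n_div: "real n / real N - 1 \<le> real (n div N)" "real (n div N) \<le> real n / real N"
    using N of_nat_mono[OF div_times_less_eq_dividend[of n N], where 'a = real]
    by (simp_all add: field_simps)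
  have "(\<Sum>r\<in>?T'. real (card (?A r))) \<le> (\<Sum>r\<in>?T'. real n / real N + 1)"
  proof (rule sum_mono)
    fix r assume "r \<in> ?T'"
    then have "card (?A r) \<le> n div N + 1" by (intro card_residue_class(2)) simp
    then have "real (card (?A r)) \<le> real (n div N) + 1" by linarith
    then show "real (card (?A r)) \<le> real n / real N + 1" using n_div(2) by linarith
  qed
  then show "real (card {v\<in>{..<n}. e (v mod N) \<in> T}) \<le> (real n / real N + 1) * real (card T)"
    unfolding sum by (simp only: sum_constant card_T' mult.commute)
  have "(\<Sum>r\<in>?T'. real n / real N - 1) \<le> (\<Sum>r\<in>?T'. real (card (?A r)))"
  proof (rule sum_mono)
    fix r assume "r \<in> ?T'"
    then have "n div N \<le> card (?A r)" by (intro card_residue_class(1)) simp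
    then have "real (n div N) \<le> real (card (?A r))" by simp
    then show "real n / real N - 1 \<le> real (card (?A r))" using n_div(1) by linarith
  qed
  then show "(real n / real N - 1) * real (card T) \<le> real (card {v\<in>{..<n}. e (v mod N) \<in> T})"
    unfolding sum by (simp only: sum_constant card_T' mult.commute)
qed

section \<open>Edge counts and density from degrees\<close>

lemma two_card_edges:
  fixes V :: "nat set"
  assumes V: "finite V" and sym: "\<And>v w. v \<in> V \<Longrightarrow> w \<in> V \<Longrightarrow> A v w \<Longrightarrow> A w v"
  shows "2 * card {{v, w} |v w. v \<in> V \<and> w \<in> V \<and> v \<noteq> w \<and> A v w} = (\<Sum>v\<in>V. card {w\<in>V. v \<noteq> w \<and> A v w})"
proof -
  \<comment> \<open>The order on \<open>nat\<close> selects one orientation of each edge;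
    \<open>?P'\<close> holds the opposite orientations.\<close>
  let ?P = "{(v, w). v \<in> V \<and> w \<in> V \<and> v < w \<and> A v w}"
  let ?P' = "{(v, w). v \<in> V \<and> w \<in> V \<and> w < v \<and> A v w}"
  have fin: "finite ?P" "finite ?P'"
    by (rule finite_subset[of _ "V \<times> V"]; use V in auto)+
  have inj: "inj_on (\<lambda>(v, w). {v, w}) ?P"
    by (rule inj_onI) (auto simp: doubleton_eq_iff)
  have img: "(\<lambda>(v, w). {v, w}) ` ?P = {{v, w} |v w. v \<in> V \<and> w \<in> V \<and> v \<noteq> w \<and> A v w}"
  proof (intro equalityI subsetI)
    fix E assume "E \<in> {{v, w} |v w. v \<in> V \<and> w \<in> V \<and> v \<noteq> w \<and> A v w}"
    then obtain v w where vw: "E = {v, w}" "v \<in> V" "w \<in> V" "v \<noteq> w" "A v w" by blast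
    show "E \<in> (\<lambda>(v, w). {v, w}) ` ?P"
    proof (cases "v < w")
      case True
      then show ?thesis using vw by (intro image_eqI[of _ _ "(v, w)"]) auto
    next
      case False
      then show ?thesis using vw sym by (intro image_eqI[of _ _ "(w, v)"]) auto
    qed
  qed fastforce
  have edges: "card {{v, w} |v w. v \<in> V \<and> w \<in> V \<and> v \<noteq> w \<and> A v w} = card ?P"
    using card_image[OF inj] unfolding img .
  have "bij_betw prod.swap ?P ?P'"
    by (rule bij_betw_byWitness[where f' = prod.swap]) (use sym in auto)
  then have swap: "card ?P' = card ?P" by (simp add: bij_betw_same_card)
  have "(\<Sum>v\<in>V. card {w\<in>V. v \<noteq> w \<and> A v w}) = card (SIGMA v:V. {w\<in>V. v \<noteq> w \<and> A v w})"
    using V by simp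
  also have "(SIGMA v:V. {w\<in>V. v \<noteq> w \<and> A v w}) = ?P \<union> ?P'" by auto
  also have "card (?P \<union> ?P') = card ?P + card ?P'"
    by (rule card_Un_disjoint) (use fin in auto)
  finally show ?thesis by (simp add: edges swap)
qed

lemma edge_density_near:
  fixes V :: "nat set"
  assumes V: "finite V" "2 \<le> card V"
    and sym: "\<And>v w. v \<in> V \<Longrightarrow> w \<in> V \<Longrightarrow> A v w \<Longrightarrow> A w v"
    and deg: "\<And>v. v \<in> V \<Longrightarrow> \<bar>real (card {w\<in>V. v \<noteq> w \<and> A v w}) - \<rho> * (real (card V) - 1)\<bar> \<le> \<epsilon> * (real (card V) - 1)"
  shows "\<bar>edge_density V {{v, w} |v w. v \<in> V \<and> w \<in> V \<and> v \<noteq> w \<and> A v w} - \<rho>\<bar> \<le> \<epsilon>"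
proof -
  let ?E = "{{v, w} |v w. v \<in> V \<and> w \<in> V \<and> v \<noteq> w \<and> A v w}" and ?n = "real (card V)"
  let ?deg = "\<lambda>v. real (card {w\<in>V. v \<noteq> w \<and> A v w})"
  have n: "?n * (?n - 1) > 0" using V(2) by simp
  have "2 * card ?E = (\<Sum>v\<in>V. card {w\<in>V. v \<noteq> w \<and> A v w})"
    by (rule two_card_edges[OF V(1)], rule sym)
  from arg_cong[OF this, of real]
  have "2 * real (card ?E) = real (\<Sum>v\<in>V. card {w\<in>V. v \<noteq> w \<and> A v w})"
    by (simp only: of_nat_mult of_nat_numeral)
  also have "\<dots> = (\<Sum>v\<in>V. ?deg v)" by (rule of_nat_sum)
  finally have "\<bar>2 * real (card ?E) - \<rho> * (?n * (?n - 1))\<bar> = \<bar>\<Sum>v\<in>V. ?deg v - \<rho> * (?n - 1)\<bar>"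
    by (simp only: sum_subtractf sum_constant mult.left_commute[of \<rho>])
  also have "\<dots> \<le> (\<Sum>v\<in>V. \<bar>?deg v - \<rho> * (?n - 1)\<bar>)" by (rule sum_abs)
  also have "\<dots> \<le> (\<Sum>v\<in>V. \<epsilon> * (?n - 1))" by (intro sum_mono deg)
  also have "\<dots> = \<epsilon> * (?n * (?n - 1))" by simp
  finally have bound: "\<bar>2 * real (card ?E) - \<rho> * (?n * (?n - 1))\<bar> \<le> \<epsilon> * (?n * (?n - 1))" .
  have "2 * real (card V choose 2) = ?n * (?n - 1)"
  proof -
    have "2 * (card V choose 2) = card V * (card V - 1)"
      unfolding choose_two by (rule dvd_mult_div_cancel) auto
    from arg_cong[OF this, of real] show ?thesis
      using V(2) by (simp only: of_nat_mult of_nat_numeral) (simp add: of_nat_diff)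
  qed
  moreover have "edge_density V ?E = 2 * real (card ?E) / (2 * real (card V choose 2))"
    by (simp add: edge_density_def)
  ultimately have "edge_density V ?E = 2 * real (card ?E) / (?n * (?n - 1))"
    by (simp only:)
  moreover have "\<rho> * (?n * (?n - 1)) / (?n * (?n - 1)) = \<rho>"
    by (rule nonzero_mult_div_cancel_right) (use n in linarith)
  ultimately have "edge_density V ?E - \<rho> = (2 * real (card ?E) - \<rho> * (?n * (?n - 1))) / (?n * (?n - 1))"
    by (simp only: diff_divide_distrib)
  then have "\<bar>edge_density V ?E - \<rho>\<bar> = \<bar>2 * real (card ?E) - \<rho> * (?n * (?n - 1))\<bar> / (?n * (?n - 1))"
    using n by (simp only: abs_divide abs_of_pos)
  then show ?thesis using bound n by (simp only: pos_divide_le_eq)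
qed

section \<open>Transfer from the word graph to all large \<open>n\<close>\<close>

theorem theorem1p2:
  fixes p q :: nat
  assumes "0 < p" and "p < q"
  shows "\<forall>\<epsilon>::real. \<epsilon> > 0 \<longrightarrow> (\<exists>n0::nat. \<forall>n\<ge>n0.
    \<exists>(V :: nat set) (E :: nat set set).
      simple_graph V E \<and> card V = n \<and>
      edge_density V E \<in> {real p / real q - \<epsilon> .. real p / real q + \<epsilon>} \<and>
      (\<forall>U. U \<subseteq> V \<and> real (card U) \<ge> \<epsilon> * real n \<longrightarrow>
        (\<exists>Q. Q \<subseteq> U \<and> card Q = q \<and>
          (\<forall>S. S \<subseteq> Q \<and> card S = p + 1 \<longrightarrow>
            real (card (common_neighbors V E S)) < \<epsilon> * real n))))"
proof (intro allI impI)
  fix \<epsilon> :: real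
  assume "0 < \<epsilon>"
  define \<eta> where "\<eta> = \<epsilon> / 4"
  define \<rho> where "\<rho> = real p / real q"
  have \<eta>: "0 < \<eta>" "\<epsilon> = 4 * \<eta>" using \<open>0 < \<epsilon>\<close> by (simp_all add: \<eta>_def)
  have \<rho>: "0 \<le> \<rho>" "\<rho> \<le> 1" using assms by (simp_all add: \<rho>_def)
  \<comment> \<open>The word graph is used at density \<open>2 * \<eta>\<close>: a set of at least
    \<open>4 * \<eta> * n\<close> vertices meets at least \<open>2 * \<eta> * N\<close> classes,
    since a class has at most \<open>n / N + 1\<close> vertices and
    \<open>N \<le> n\<close>.\<close>
  have params: "0 < q" "p \<le> q" "0 < 2 * \<eta>" "0 < \<eta>" using assms \<eta>(1) by simp_all
  obtain \<Omega> :: "(nat \<Rightarrow> nat) set" and R where \<Omega>: "finite \<Omega>" "\<Omega> \<noteq> {}"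
    and R_sym: "\<And>x y. x \<in> \<Omega> \<Longrightarrow> y \<in> \<Omega> \<Longrightarrow> R x y \<Longrightarrow> R y x"
    and R_deg: "\<And>x. x \<in> \<Omega> \<Longrightarrow> \<bar>real (card {y\<in>\<Omega>. R x y}) - \<rho> * real (card \<Omega>)\<bar> \<le> \<eta> * real (card \<Omega>)"
    and R_few: "\<And>U. U \<subseteq> \<Omega> \<Longrightarrow> 2 * \<eta> * real (card \<Omega>) \<le> real (card U) \<Longrightarrow>
      \<exists>Q\<subseteq>U. card Q = q \<and> (\<forall>S\<subseteq>Q. card S = p + 1 \<longrightarrow>
        real (card {y\<in>\<Omega>. \<forall>x\<in>S. R x y}) \<le> \<eta> * real (card \<Omega>))"
    by (rule exists_word_graph[OF params, folded \<rho>_def], rule that)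
  define N where "N = card \<Omega>"
  have N: "0 < N" using \<Omega> by (simp add: N_def card_gt_0_iff)
  obtain e where e: "bij_betw e {..<N} \<Omega>"
    using ex_bij_betw_nat_finite[OF \<Omega>(1)] unfolding N_def atLeast0LessThan by blast
  \<comment> \<open>The summand \<open>4\<close> pays for the \<open>4 * \<eta>\<close> lost in
    passing from \<open>n\<close> to \<open>n - 1\<close> in the degree bound. The second bound
    makes rounding of the classes and removal of the vertex itself cost at most
    \<open>\<eta> * n\<close>.\<close>
  define n0 where "n0 = max (N + 4) (nat \<lceil>(real N + 1) / \<eta>\<rceil>)"
  show "\<exists>n0. \<forall>n\<ge>n0. \<exists>(V :: nat set) (E :: nat set set).
      simple_graph V E \<and> card V = n \<and>
      edge_density V E \<in> {real p / real q - \<epsilon> .. real p / real q + \<epsilon>} \<and>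
      (\<forall>U. U \<subseteq> V \<and> real (card U) \<ge> \<epsilon> * real n \<longrightarrow>
        (\<exists>Q. Q \<subseteq> U \<and> card Q = q \<and>
          (\<forall>S. S \<subseteq> Q \<and> card S = p + 1 \<longrightarrow>
            real (card (common_neighbors V E S)) < \<epsilon> * real n)))"
    unfolding \<rho>_def[symmetric]
  proof (intro exI[of _ n0] allI impI)
    fix n assume "n0 \<le> n"
    then have n_ge: "N + 4 \<le> n" and "(real N + 1) / \<eta> \<le> real n"
      by (auto simp: n0_def)
    then have n_large: "real N + 1 \<le> \<eta> * real n" using \<eta> by (simp add: field_simps)
    have n_large': "\<eta> * real N + 4 * \<eta> \<le> \<eta> * real n"
      using mult_left_mono[of "real N + 4" "real n" \<eta>] n_ge \<eta>(1) by (simp add: distrib_left)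
    define V where "V = {..<n}"
    define \<phi> where "\<phi> v = e (v mod N)" for v
    define A where "A v w = R (\<phi> v) (\<phi> w)" for v w
    \<comment> \<open>\<open>R\<close> may relate a word to itself, so distinct copies of one word
      can be joined; only \<open>v = w\<close> is excluded.\<close>
    define E where "E = {{v, w} |v w. v \<in> V \<and> w \<in> V \<and> v \<noteq> w \<and> A v w}"
    have V: "finite V" "card V = n" by (simp_all add: V_def)
    have \<phi>_in: "\<phi> v \<in> \<Omega>" for v
      using bij_betwE[OF e] N by (simp add: \<phi>_def)
    have A_sym: "A w v" if "A v w" for v w
      using that R_sym[OF \<phi>_in \<phi>_in] by (simp add: A_def)
    have blow_up: "real (card {v\<in>V. \<phi> v \<in> T}) \<le> (real n / real N + 1) * real (card T)"
      "(real n / real N - 1) * real (card T) \<le> real (card {v\<in>V. \<phi> v \<in> T})" if "T \<subseteq> \<Omega>" for T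
      using card_blowup[OF e that N, of n] by (simp_all only: V_def \<phi>_def)
    have quot: "(real n / real N + 1) * (c * real N) = c * (real n + real N)"
      "(real n / real N - 1) * (c * real N) = c * (real n - real N)" for c
      using N by (simp_all add: field_simps)
    have quot_ge: "0 \<le> real n / real N - 1" using N n_ge by simp
    have "simple_graph V E"
      unfolding simple_graph_def E_def using V(1) by auto
    moreover have "\<bar>edge_density V E - \<rho>\<bar> \<le> \<epsilon>"
      unfolding E_def
    proof (rule edge_density_near)
      fix v assume "v \<in> V"
      let ?T = "{y\<in>\<Omega>. R (\<phi> v) y}"
      let ?X = "{w\<in>V. \<phi> w \<in> ?T}" and ?D = "real (card {w\<in>V. v \<noteq> w \<and> A v w})"
      have T: "(\<rho> - \<eta>) * real N \<le> real (card ?T)" "real (card ?T) \<le> (\<rho> + \<eta>) * real N"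
        using R_deg[OF \<phi>_in, of v] by (simp_all only: N_def left_diff_distrib distrib_right abs_le_iff) linarith+
      have sub: "?T \<subseteq> \<Omega>" by blast
      have "real (card ?X) \<le> (real n / real N + 1) * ((\<rho> + \<eta>) * real N)"
        by (rule order_trans[OF blow_up(1)[OF sub]]) (intro mult_left_mono T, simp)
      then have upper: "real (card ?X) \<le> (\<rho> + \<eta>) * (real n + real N)" by (simp only: quot)
      have "(real n / real N - 1) * ((\<rho> - \<eta>) * real N) \<le> real (card ?X)"
        by (rule order_trans[OF _ blow_up(2)[OF sub]]) (intro mult_left_mono T quot_ge)
      then have lower: "(\<rho> - \<eta>) * (real n - real N) \<le> real (card ?X)" by (simp only: quot)
      have eq: "{w\<in>V. v \<noteq> w \<and> A v w} = ?X - {v}"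
        using \<phi>_in by (auto simp: A_def)
      have "card (?X - {v}) \<le> card ?X" "card ?X - 1 \<le> card (?X - {v})"
        using V(1) by (auto intro: card_mono simp: card_Diff_singleton_if)
      then have D: "?D \<le> real (card ?X)" "real (card ?X) - 1 \<le> ?D"
        unfolding eq by linarith+
      have \<rho>N: "\<rho> * real N \<le> real N" using mult_right_mono[OF \<rho>(2), of "real N"] by simp
      have "?D \<le> \<rho> * real n + \<rho> * real N + \<eta> * real n + \<eta> * real N"
        using D(1) upper by (simp only: distrib_left distrib_right)
      moreover have "\<rho> * real n - \<rho> * real N - \<eta> * real n + \<eta> * real N - 1 \<le> ?D"
        using D(2) lower by (simp only: left_diff_distrib right_diff_distrib)
      moreover have "0 \<le> \<eta> * real N" using \<eta>(1) by simp
      moreover have "\<rho> * (real n - 1) = \<rho> * real n - \<rho>" "\<epsilon> * (real n - 1) = 4 * (\<eta> * real n) - 4 * \<eta>"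
        by (simp_all add: right_diff_distrib \<eta>(2))
      ultimately show "\<bar>?D - \<rho> * (real (card V) - 1)\<bar> \<le> \<epsilon> * (real (card V) - 1)"
        unfolding V(2) using \<rho>N \<rho> n_large n_large' \<eta>(1) by linarith
    qed (use V n_ge A_sym in auto)
    then have "edge_density V E \<in> {\<rho> - \<epsilon> .. \<rho> + \<epsilon>}"
      unfolding atLeastAtMost_iff by linarith
    moreover have "\<exists>Q. Q \<subseteq> U \<and> card Q = q \<and>
          (\<forall>S. S \<subseteq> Q \<and> card S = p + 1 \<longrightarrow> real (card (common_neighbors V E S)) < \<epsilon> * real n)"
      if U: "U \<subseteq> V" "\<epsilon> * real n \<le> real (card U)" for U
    proof -
      have n_pos: "0 < \<eta> * real n" using \<eta>(1) n_ge by simp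
      have "\<phi> ` U \<subseteq> \<Omega>" using \<phi>_in by blast
      have "card U \<le> card {v\<in>V. \<phi> v \<in> \<phi> ` U}" using U(1) V(1) by (intro card_mono) auto
      then have "4 * (\<eta> * real n) \<le> (real n / real N + 1) * real (card (\<phi> ` U))"
        using blow_up(1)[OF \<open>\<phi> ` U \<subseteq> \<Omega>\<close>] U(2)[unfolded \<eta>(2) mult.assoc] by linarith
      moreover have "(real n / real N + 1) * (2 * \<eta> * real N) \<le> 4 * (\<eta> * real n)"
        using quot(1)[of "2 * \<eta>"] n_ge \<eta>(1) by (simp add: distrib_left)
      ultimately have "(real n / real N + 1) * (2 * \<eta> * real N) \<le> (real n / real N + 1) * real (card (\<phi> ` U))"
        by linarith
      then have "2 * \<eta> * real N \<le> real (card (\<phi> ` U))"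
        by (rule mult_left_le_imp_le) (simp add: add_nonneg_pos)
      then obtain Q' where Q': "Q' \<subseteq> \<phi> ` U" "card Q' = q"
        and few: "\<And>S. S \<subseteq> Q' \<Longrightarrow> card S = p + 1 \<Longrightarrow> real (card {y\<in>\<Omega>. \<forall>x\<in>S. R x y}) \<le> \<eta> * real N"
        using R_few[OF \<open>\<phi> ` U \<subseteq> \<Omega>\<close>] unfolding N_def by blast
      \<comment> \<open>One representative in \<open>U\<close> is chosen for each word of
        \<open>Q'\<close>, so that \<open>p + 1\<close> vertices of \<open>Q\<close> project to
        \<open>p + 1\<close> distinct words.\<close>
      obtain Q where Q: "Q \<subseteq> U" "inj_on \<phi> Q" "Q' = \<phi> ` Q"
        using Q'(1) by (metis subset_image_inj)
      have "real (card (common_neighbors V E S)) < \<epsilon> * real n" if S: "S \<subseteq> Q" "card S = p + 1" for S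
      proof -
        let ?T = "{y\<in>\<Omega>. \<forall>x\<in>\<phi> ` S. R x y}"
        have "card (\<phi> ` S) = p + 1"
          using S card_image[OF inj_on_subset[OF Q(2) S(1)]] by simp
        moreover have "\<phi> ` S \<subseteq> Q'" using S(1) Q(3) by blast
        ultimately have T: "real (card ?T) \<le> \<eta> * real N" by (intro few)
        have edge: "A v w" if "{v, w} \<in> E" for v w
          using that A_sym unfolding E_def by (auto simp: doubleton_eq_iff)
        have "common_neighbors V E S \<subseteq> {w\<in>V. \<phi> w \<in> ?T}"
          using edge \<phi>_in by (auto simp: common_neighbors_def A_def)
        then have "real (card (common_neighbors V E S)) \<le> real (card {w\<in>V. \<phi> w \<in> ?T})"
          using V(1) by (intro of_nat_mono card_mono) auto
        also have "\<dots> \<le> (real n / real N + 1) * real (card ?T)"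
          by (rule blow_up(1)) blast
        also have "\<dots> \<le> (real n / real N + 1) * (\<eta> * real N)"
          by (intro mult_left_mono T) simp
        also have "\<dots> = \<eta> * real n + \<eta> * real N" by (simp only: quot distrib_left)
        \<comment> \<open>Strictness has room to spare: \<open>N \<le> n\<close> bounds the left
          side by \<open>2 * \<eta> * n\<close>, half of the right side.\<close>
        also have "\<dots> < \<epsilon> * real n"
          unfolding \<eta>(2) mult.assoc using n_large' n_pos \<eta>(1) by linarith
        finally show ?thesis .
      qed
      moreover have "card Q = q" using Q'(2) Q(2,3) by (simp add: card_image)
      ultimately show ?thesis using Q(1) by blast
    qed
    ultimately show "\<exists>(V :: nat set) (E :: nat set set).
      simple_graph V E \<and> card V = n \<and>
      edge_density V E \<in> {\<rho> - \<epsilon> .. \<rho> + \<epsilon>} \<and>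
      (\<forall>U. U \<subseteq> V \<and> real (card U) \<ge> \<epsilon> * real n \<longrightarrow>
        (\<exists>Q. Q \<subseteq> U \<and> card Q = q \<and>
          (\<forall>S. S \<subseteq> Q \<and> card S = p + 1 \<longrightarrow>
            real (card (common_neighbors V E S)) < \<epsilon> * real n)))"
      using V(2) by (intro exI[of _ V] exI[of _ E]) simp
  qed
qed

end
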